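(* Let $k\ge3$ and let $(q_m)_{m\ge1}$ be an increasing sequence of prime powers, $q_m=p_m^{e_m}$. For each $m$ let $S(k,q_m)=S(k,q_m;f_{3,m},g_{3,m},\ldots,f_{k,m},g_{k,m})$ with $g_{i,m}(0)=0$ for all $i$, and suppose $d_f^{(m)}\ge1$ and $1\le d_g^{(m)}<p_m$ for all $m$. Let $\lambda^{(m)}$ be the largest eigenvalue of $S(k,q_m)$ that is different from $q_m(q_m-1)$. Then for every $m$, $\lambda^{(m)}\le d_f^{(m)}q_m+d_g^{(m)}q_m^{3/2}$; in particular $\lambda^{(m)}=\max\bigl(O(d_f^{(m)}q_m),\,O(d_g^{(m)}q_m^{3/2})\bigr)$.
   Context: For a prime power $q$, $k\ge3$, and $f_i,g_i\in\mathbb{F}_q[X]$ ($3\le i\le k$) of degree at most $q-1$ with $g_i(-X)=-g_i(X)$, $S(k,q;f_3,g_3,\ldots,f_k,g_k)$ is the simple graph on vertex set $\mathbb{F}_q^k$ in which $a$ and $b$ are adjacent iff $a_1\ne b_1$ and $b_i-a_i=g_i(b_1-a_1)f_i\!\left(\frac{b_2-a_2}{b_1-a_1}\right)$ for $3\le i\le k$; it is $q(q-1)$-regular. $d_f^{(m)}=\max_{3\le i\le k}\deg f_{i,m}$ and $d_g^{(m)}=\max_{3\le i\le k}\deg g_{i,m}$. Eigenvalues are those of the adjacency matrix. *)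

theory Defs
  imports Complex_Main "HOL-Computational_Algebra.Polynomial" "HOL-Library.Cardinality"
begin

text \<open>Vertex set F_q^k: vectors a with coordinates a 1, ..., a k (zero outside 1..k).\<close>
definition S_vertices :: "nat \<Rightarrow> (nat \<Rightarrow> 'a::zero) set" where
  "S_vertices k = {a. \<forall>i. (i = 0 \<or> k < i) \<longrightarrow> a i = 0}"

definition S_adj :: "nat \<Rightarrow> (nat \<Rightarrow> 'a::field poly) \<Rightarrow> (nat \<Rightarrow> 'a poly)
    \<Rightarrow> (nat \<Rightarrow> 'a) \<Rightarrow> (nat \<Rightarrow> 'a) \<Rightarrow> bool" where
  "S_adj k f g a b \<longleftrightarrow> a 1 \<noteq> b 1 \<and>
     (\<forall>i\<in>{3..k}. b i - a i = poly (g i) (b 1 - a 1) * poly (f i) ((b 2 - a 2) / (b 1 - a 1)))"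

definition S_eigenvalue :: "nat \<Rightarrow> (nat \<Rightarrow> 'a::{field,finite} poly) \<Rightarrow> (nat \<Rightarrow> 'a poly)
    \<Rightarrow> real \<Rightarrow> bool" where
  "S_eigenvalue k f g mu \<longleftrightarrow>
     (\<exists>x :: (nat \<Rightarrow> 'a) \<Rightarrow> real. (\<exists>v\<in>S_vertices k. x v \<noteq> 0) \<and>
        (\<forall>a\<in>S_vertices k.
           (\<Sum>b\<in>S_vertices k. (if S_adj k f g a b then 1 else 0) * x b) = mu * x a))"

definition d_f :: "nat \<Rightarrow> (nat \<Rightarrow> 'a::zero poly) \<Rightarrow> nat" where
  "d_f k f = Max ((\<lambda>i. degree (f i)) ` {3..k})"

end

theory Submission
  imports Defs "HOL-Algebra.Algebraic_Closure_Type"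
    "HOL-Computational_Algebra.Polynomial_FPS"
    "HOL-Computational_Algebra.Fundamental_Theorem_Algebra"
begin

text \<open>
  The graph is a Cayley graph of the additive group of $F_q^k$, so its eigenvalues are the sums of
  $\psi(- H_u(s))$ over $u$ and $s \neq 0$, where $H_u$ is a linear combination of $s$ and the
  $g_i(s)$ whose coefficients are polynomials in $u$ of degree at most $d_f$. Either all $H_u$
  vanish, which gives the eigenvalue $q(q-1)$, or at most $d_f$ of them do and Weil's bound
  $(d_g - 1) \sqrt q$ applies to the others; it is available because $\deg H_u \le d_g < p$.

  Weil's bound for $h$ of degree $d$ prime to $p$ is obtained by Stepanov's method. With
  $Q = q^{m+M}$ split $\mathrm{Tr}(h) = v + w^{q^m}$, where $v$ and $w$ are the sums of the first $m$
  and $M$ Frobenius powers of $h$. Linear algebra gives a relation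
  $\sum \gamma_{ijk} X^{q^m k + i} v^j = 0$, and replacing $X^i$ by $X^{iQ}$, $v$ by $(a - w)^{q^m}$
  and taking $q^m$-th roots yields a non-zero polynomial of small degree that vanishes at all
  $x \in F_Q$ with $\mathrm{Tr}(h(x)) = a$. Hence the character sums over $F_{q^n}$ are
  $O(q^{n/2})$. They are the coefficients of the logarithmic derivative of an L-function that is a
  polynomial of degree less than $d$, so this growth keeps its zeros outside the disc
  $|z| < 1 / \sqrt q$, and the sum over $F_q$ is its linear coefficient.
\<close>

(* HOL-Algebra's constants of the same names would shadow those of type-class polynomials. *)
hide_const (open) Polynomials.degree Polynomials.lead_coeff Coset.order UnivPoly.coeff UnivPoly.monom
  Divisibility.prime Module.smult

section \<open>Preliminaries on fields and polynomials\<close>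

text \<open>Over \<open>F_q\<close> alone Stepanov's method is too weak by a factor depending on
  \<open>q\<close> and on the degree \<open>d\<close>. Over \<open>F_{q^n}\<close> with
  \<open>n\<close> large it loses the same factor each time, and a factor independent of
  \<open>n\<close> does not change the radius of convergence of \<open>sum S_n z^n\<close>; the
  sharp constant \<open>d - 1\<close> is then the bound for the degree of the L-function. What ties
  the sums \<open>S_n\<close> to the L-function is a count of Frobenius orbits: for a monic
  polynomial of degree \<open>n\<close> over \<open>F_q\<close> there are exactly \<open>n\<close>
  pairs \<open>(k, x)\<close> with \<open>1 <= k <= n\<close> and \<open>x\<close> in
  \<open>F_{q^k}\<close> such that the characteristic polynomial of \<open>x\<close> over
  \<open>F_q\<close> divides it. This takes the place of an Euler product. That \<open>p\<close>
  does not divide \<open>d\<close> is used twice: it keeps the degrees of the terms of Stepanov's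
  polynomial apart, and it makes the coefficients of the L-function vanish from degree
  \<open>d\<close> on.\<close>

lemma homogeneous_system_nontrivial_solution:
  fixes a :: "'i \<Rightarrow> 'j \<Rightarrow> 'a::field"
  assumes "finite J" "finite I" "card J < card I"
  shows "\<exists>c. (\<exists>i\<in>I. c i \<noteq> 0) \<and> (\<forall>j\<in>J. (\<Sum>i\<in>I. a i j * c i) = 0)"
  using assms
proof (induction J arbitrary: I a rule: finite_induct)
  case empty
  then have "I \<noteq> {}" by auto
  then show ?case by (intro exI[of _ "\<lambda>_. 1"]) auto
next
  case (insert j0 J)
  show ?case
  proof (cases "\<forall>i\<in>I. a i j0 = 0")
    case True
    from insert obtain c where "\<exists>i\<in>I. c i \<noteq> 0" "\<forall>j\<in>J. (\<Sum>i\<in>I. a i j * c i) = 0"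
      using insert.IH[of I a] by (metis Suc_lessD card_insert_disjoint)
    then show ?thesis using True by (intro exI[of _ c]) auto
  next
    case False
    then obtain i0 where i0: "i0 \<in> I" "a i0 j0 \<noteq> 0" by auto
    define I' where "I' = I - {i0}"
    have I': "finite I'" "I = insert i0 I'" "i0 \<notin> I'" "card J < card I'"
      using insert i0 by (auto simp: I'_def)
    define b where "b = (\<lambda>i j. a i j - a i j0 / a i0 j0 * a i0 j)"
    obtain c where c: "\<exists>i\<in>I'. c i \<noteq> 0" "\<forall>j\<in>J. (\<Sum>i\<in>I'. b i j * c i) = 0"
      using insert.IH[of I' b] I' by auto
    define c' where "c' = c(i0 := - (\<Sum>i\<in>I'. a i j0 * c i) / a i0 j0)"
    have sum_eq: "(\<Sum>i\<in>I. a i j * c' i) = a i0 j * c' i0 + (\<Sum>i\<in>I'. a i j * c i)" for j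
    proof -
      have "(\<Sum>i\<in>I'. a i j * c' i) = (\<Sum>i\<in>I'. a i j * c i)"
        using I' by (intro sum.cong) (auto simp: c'_def)
      then show ?thesis using I' by simp
    qed
    have "(\<Sum>i\<in>I. a i j0 * c' i) = 0"
      unfolding sum_eq using i0 by (simp add: c'_def)
    moreover have "(\<Sum>i\<in>I. a i j * c' i) = 0" if "j \<in> J" for j
    proof -
      have "0 = (\<Sum>i\<in>I'. b i j * c i)" using c that by simp
      also have "\<dots> = (\<Sum>i\<in>I'. a i j * c i) - (\<Sum>i\<in>I'. a i0 j / a i0 j0 * (a i j0 * c i))"
        unfolding b_def sum_subtractf [symmetric] by (intro sum.cong) (auto simp: field_simps)
      also have "\<dots> = (\<Sum>i\<in>I. a i j * c' i)"
        unfolding sum_eq sum_distrib_left [symmetric] by (simp add: c'_def)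
      finally show ?thesis by simp
    qed
    moreover have "\<exists>i\<in>I. c' i \<noteq> 0"
      using c(1) I' by (auto simp: c'_def)
    ultimately show ?thesis by (intro exI[of _ c']) auto
  qed
qed

text \<open>The summand of greatest degree has nothing to cancel against. This is how Stepanov's
  polynomial is seen to be nonzero.\<close>

lemma sum_distinct_degree_nonzero:
  fixes f :: "'i \<Rightarrow> 'a::comm_monoid_add poly"
  assumes "finite A" "i \<in> A" "f i \<noteq> 0"
    and inj: "\<And>i j. i \<in> A \<Longrightarrow> j \<in> A \<Longrightarrow> f i \<noteq> 0 \<Longrightarrow> f j \<noteq> 0 \<Longrightarrow> degree (f i) = degree (f j) \<Longrightarrow> i = j"
  shows "(\<Sum>i\<in>A. f i) \<noteq> 0"
proof -
  define B where "B = {i\<in>A. f i \<noteq> 0}"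
  have B: "finite B" "B \<noteq> {}" using assms by (auto simp: B_def)
  obtain m where m: "m \<in> B" "\<And>j. j \<in> B \<Longrightarrow> degree (f j) \<le> degree (f m)"
  proof -
    have "Max ((\<lambda>i. degree (f i)) ` B) \<in> (\<lambda>i. degree (f i)) ` B"
      using B by (intro Max_in) auto
    then obtain m where "m \<in> B" "degree (f m) = Max ((\<lambda>i. degree (f i)) ` B)"
      by auto
    with B show ?thesis by (intro that[of m]) auto
  qed
  have "coeff (\<Sum>i\<in>A. f i) (degree (f m)) = (\<Sum>i\<in>A. coeff (f i) (degree (f m)))"
    by (simp add: coeff_sum)
  also have "\<dots> = (\<Sum>i\<in>{m}. coeff (f i) (degree (f m)))"
  proof (rule sum.mono_neutral_right)
    show "\<forall>i\<in>A - {m}. coeff (f i) (degree (f m)) = 0"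
    proof
      fix i assume i: "i \<in> A - {m}"
      show "coeff (f i) (degree (f m)) = 0"
      proof (cases "f i = 0")
        case False
        then have "degree (f i) \<le> degree (f m)" "degree (f i) \<noteq> degree (f m)"
          using m i inj[of i m] by (auto simp: B_def)
        then show ?thesis by (intro coeff_eq_0) auto
      qed auto
    qed
  qed (use assms m in \<open>auto simp: B_def\<close>)
  also have "\<dots> \<noteq> 0" using m by (auto simp: B_def)
  finally show ?thesis by auto
qed

section \<open>Finite fields and powers of the characteristic\<close>

lemma power_card_eq_same:
  fixes x :: "'a::{field,finite}"
  shows "x ^ CARD('a) = x"
proof (cases "x = 0")
  case False
  have "x * (\<Prod>y\<in>UNIV-{0}. x * y) = x * x ^ (CARD('a) - 1) * \<Prod>(UNIV-{0})"
    by (simp add: prod.distrib mult_ac)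
  also have "x * x ^ (CARD('a) - 1) = x ^ Suc (CARD('a) - 1)"
    by (subst power_Suc) auto
  also have "Suc (CARD('a) - 1) = CARD('a)"
    using finite_UNIV_card_ge_0[where ?'a = 'a] by simp
  also have "(\<Prod>y\<in>UNIV-{0}. x * y) = (\<Prod>y\<in>UNIV-{0}. y)"
    by (rule prod.reindex_bij_witness[of _ "\<lambda>y. y / x" "\<lambda>y. x * y"]) (use False in auto)
  finally show ?thesis
    by simp
qed (use finite_UNIV_card_ge_0[where ?'a = 'a] in auto)

lemma prime_CHAR_finite: "prime CHAR('a::{field,finite})"
  by (intro prime_CHAR_semidom finite_imp_CHAR_pos) auto

lemma power_CHAR_power_eq_0_iff: "x ^ (CHAR('a) ^ n) = 0 \<longleftrightarrow> x = (0::'a::idom)" if "prime CHAR('a)"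
  using that by (auto simp: prime_gt_0_nat)

lemma minus_power_CHAR_power:
  fixes x :: "'a::idom"
  assumes "prime CHAR('a)"
  shows "(- x) ^ (CHAR('a) ^ n) = - (x ^ (CHAR('a) ^ n))"
  by (induction n arbitrary: x) (simp_all add: power_mult minus_power_prime_CHAR assms)

lemma diff_power_CHAR_power:
  fixes x y :: "'a::idom"
  assumes "prime CHAR('a)"
  shows "(x - y) ^ (CHAR('a) ^ n) = x ^ (CHAR('a) ^ n) - y ^ (CHAR('a) ^ n)"
  using freshmans_dream'[OF assms refl, of x "-y" n] minus_power_CHAR_power[OF assms, of y n] by simp

lemma inj_power_CHAR_power:
  assumes "prime CHAR('a::idom)"
  shows "inj (\<lambda>x::'a. x ^ (CHAR('a) ^ n))"
proof (rule injI)
  fix x y :: 'a assume "x ^ (CHAR('a) ^ n) = y ^ (CHAR('a) ^ n)"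
  then have "(x - y) ^ (CHAR('a) ^ n) = 0" by (simp add: diff_power_CHAR_power assms)
  then show "x = y" using assms by (simp add: power_CHAR_power_eq_0_iff)
qed

text \<open>Write \<open>q = p ^ e * b\<close> with \<open>p\<close> not dividing \<open>b\<close>.
  Every \<open>y\<close> is some \<open>x ^ (p ^ e)\<close>, so \<open>y ^ b = x ^ q = x\<close>:
  taking \<open>b\<close>-th powers inverts a power of Frobenius and is therefore additive. For
  \<open>b > 1\<close> the polynomial \<open>(X + 1) ^ b - X ^ b - 1\<close> has the nonzero
  coefficient \<open>b\<close> at \<open>X\<close> and degree below \<open>b\<close>, yet it
  vanishes at all \<open>q >= b\<close> elements.\<close>

lemma CARD_eq_CHAR_power:
  "\<exists>e>0. CARD('a::{field,finite}) = CHAR('a) ^ e"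
proof -
  define p where "p = CHAR('a)"
  define q where "q = CARD('a)"
  have p: "prime p" by (simp add: p_def prime_CHAR_finite)
  have q0: "q > 1" using card_mono[of UNIV "{0,1::'a}"] by (simp add: q_def)
  define e where "e = multiplicity p q"
  define b where "b = q div p ^ e"
  have q: "q = p ^ e * b" by (simp add: b_def e_def multiplicity_dvd)
  have nb: "\<not> p dvd b" using multiplicity_decompose[of q p] q0 prime_gt_1_nat[OF p]
    by (auto simp: b_def e_def)
  have surj: "\<exists>x::'a. y = x ^ (p ^ e)" for y :: 'a
  proof -
    have "inj (\<lambda>x::'a. x ^ (p ^ e))" unfolding p_def by (rule inj_power_CHAR_power[OF prime_CHAR_finite])
    then have "surj (\<lambda>x::'a. x ^ (p ^ e))" by (simp add: finite_UNIV_inj_surj)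
    then show ?thesis by (auto simp: surj_def)
  qed
  have add: "(y + 1) ^ b = y ^ b + 1" for y :: 'a
  proof -
    obtain x where x: "y = x ^ (p ^ e)" using surj by blast
    have card: "CARD('a) = p ^ e * b" using q by (simp add: q_def)
    have "(y + 1) ^ b = ((x + 1) ^ (p ^ e)) ^ b"
      using freshmans_dream'[OF prime_CHAR_finite refl, of x 1 e] by (simp add: x p_def)
    also have "\<dots> = x + 1" using power_card_eq_same[of "x + 1"] by (simp add: card power_mult)
    also have "x = y ^ b" using power_card_eq_same[of x] by (simp add: x card power_mult)
    finally show ?thesis .
  qed
  have b0: "b \<noteq> 0" using q q0 by (cases b) auto
  have "b = 1"
  proof (rule ccontr)
    assume "b \<noteq> 1"
    with b0 have b1: "b > 1" by simp
    define P :: "'a poly" where "P = [:1, 1:] ^ b - monom 1 b - 1"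
    have c0: "coeff ([:1,1:] ^ b) 1 = (of_nat b :: 'a)"
      using coeff_linear_poly_power[of 1 b "1::'a" 1] b1 by simp
    have "coeff P 1 = of_nat b" using b1 c0 by (simp add: P_def)
    then have P0: "P \<noteq> 0" using nb by (auto simp: p_def of_nat_eq_0_iff_char_dvd)
    have "poly P y = 0" for y using add[of y] by (simp add: P_def poly_monom add.commute)
    then have "q \<le> degree P" using card_poly_roots_bound[OF P0] by (simp add: q_def)
    moreover have "degree P \<le> b"
      unfolding P_def by (intro degree_diff_le degree_monom_le) (auto simp: degree_linear_power)
    moreover have "coeff P b = 0" using b1
      by (simp add: P_def) (metis coeff_linear_power)
    ultimately have "degree P < b" using P0
      by (metis leading_coeff_0_iff le_neq_implies_less)
    moreover have "b \<le> q" using q prime_gt_0_nat[OF p] by simp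
    ultimately show False using \<open>q \<le> degree P\<close> by simp
  qed
  then have "q = p ^ e" using q by simp
  moreover have "e > 0" using calculation q0 by (cases e) auto
  ultimately show ?thesis unfolding p_def q_def by blast
qed

section \<open>Root multisets over an algebraically closed field\<close>

lemma proots_prod_linear: "proots (\<Prod>x\<in>#A. [:-x, 1:]) = (A :: 'a::idom multiset)"
proof (induction A)
  case (add x A)
  have "(\<Prod>x\<in>#A. [:-x, 1:]) \<noteq> 0" by auto
  then have "proots ([:-x, 1:] * (\<Prod>x\<in>#A. [:-x, 1:])) = {#x#} + A"
    using add by (subst proots_mult) auto
  then show ?case by simp
qed auto

lemma size_proots_alg_closed: "size (proots (P::'a::alg_closed_field poly)) = degree P"
proof (cases "P = 0")
  case False
  then obtain A where A: "size A = degree P" "P = smult (lead_coeff P) (\<Prod>x\<in>#A. [:-x, 1:])"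
    using alg_closed_imp_factorization by blast
  have "proots P = A"
    by (subst A(2), subst proots_smult) (use False in \<open>auto simp: proots_prod_linear\<close>)
  with A show ?thesis by simp
qed auto

lemma monic_eq_prod_proots:
  assumes "lead_coeff (P::'a::alg_closed_field poly) = 1"
  shows "P = (\<Prod>x\<in>#proots P. [:-x, 1:])"
proof -
  have "P \<noteq> 0" using assms by auto
  then obtain A where "P = smult (lead_coeff P) (\<Prod>x\<in>#A. [:-x, 1:])"
    using alg_closed_imp_factorization by blast
  with assms show ?thesis by (metis proots_prod_linear smult_1_left)
qed

section \<open>Stepanov's method\<close>

lemma sum_lessThan_add: "(\<Sum>i<m + n. f i) = (\<Sum>i<m. f i) + (\<Sum>i<n. f (m + i :: nat))"
  by (induction n) (simp_all add: add.assoc)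

text \<open>All extensions of the field with \<open>q\<close> elements are cut out of one
  algebraically closed type as fixed sets of powers of Frobenius, since a type cannot vary with
  \<open>n\<close>. \<open>K\<close> names that type when the locale is interpreted.\<close>

locale finite_subfields =
  fixes q e :: nat and K :: "'a::alg_closed_field itself"
  assumes prime_char: "prime CHAR('a)" and q_eq: "q = CHAR('a) ^ e" and e_pos: "e > 0"
begin

definition F :: "nat \<Rightarrow> 'a set" where "F n = {x. x ^ (q ^ n) = x}"

abbreviation Fq :: "'a set" where "Fq \<equiv> F (Suc 0)"

text \<open>On \<open>F n\<close> this is the trace to \<open>Fq\<close>.\<close>

definition tr :: "nat \<Rightarrow> 'a \<Rightarrow> 'a" where "tr n x = (\<Sum>i<n. x ^ (q ^ i))"

lemma q_power: "q ^ n = CHAR('a) ^ (e * n)"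
  by (simp add: q_eq power_mult)

lemma q_gt_1: "q > 1"
  unfolding q_eq by (rule one_less_power[OF prime_gt_1_nat[OF prime_char] e_pos])

lemma q_pos [simp]: "q > 0"
  using q_gt_1 by simp

lemma power_q_add: "(x + y :: 'a) ^ (q ^ n) = x ^ (q ^ n) + y ^ (q ^ n)"
  by (rule freshmans_dream'[OF prime_char q_power])

lemma power_q_sum: "(sum f A :: 'a) ^ (q ^ n) = (\<Sum>x\<in>A. f x ^ (q ^ n))"
  by (rule freshmans_dream_sum'[OF prime_char q_power])

lemma power_q_diff: "(x - y :: 'a) ^ (q ^ n) = x ^ (q ^ n) - y ^ (q ^ n)"
  using diff_power_CHAR_power[OF prime_char] by (simp add: q_power)

lemma power_q_minus: "(- x :: 'a) ^ (q ^ n) = - (x ^ (q ^ n))"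
  using minus_power_CHAR_power[OF prime_char] by (simp add: q_power)

lemma power_q_inj: "x ^ (q ^ n) = y ^ (q ^ n) \<longleftrightarrow> x = (y :: 'a)"
  using inj_power_CHAR_power[OF prime_char, of "e * n"] by (auto simp: q_power inj_def)

lemma of_nat_q_power: "n > 0 \<Longrightarrow> of_nat (q ^ n) = (0 :: 'a)"
  unfolding of_nat_eq_0_iff_char_dvd using e_pos by (simp add: q_power)

lemma F_0: "0 \<in> F n" by (simp add: F_def)

lemma F_add: "x \<in> F n \<Longrightarrow> y \<in> F n \<Longrightarrow> x + y \<in> F n"
  by (simp add: F_def power_q_add)

lemma F_diff: "x \<in> F n \<Longrightarrow> y \<in> F n \<Longrightarrow> x - y \<in> F n"
  by (simp add: F_def power_q_diff)

lemma F_minus: "x \<in> F n \<Longrightarrow> - x \<in> F n"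
  by (simp add: F_def power_q_minus)

lemma F_mult: "x \<in> F n \<Longrightarrow> y \<in> F n \<Longrightarrow> x * y \<in> F n"
  by (simp add: F_def power_mult_distrib)

lemma Fq_power_q: "x \<in> Fq \<Longrightarrow> x ^ (q ^ n) = x"
  by (induction n) (auto simp: F_def power_mult)

lemma Fq_of_nat: "of_nat k \<in> Fq"
proof (induction k)
  case (Suc k)
  have "1 \<in> Fq" by (simp add: F_def)
  then show ?case using F_add[OF _ Suc, of 1] by simp
qed (simp add: F_0)

text \<open>\<open>X ^ (q ^ n) - X\<close> has derivative \<open>- 1\<close>, so all its roots are
  simple and their number is its degree.\<close>

lemma finite_F: "n > 0 \<Longrightarrow> finite (F n)"
  and card_F: "n > 0 \<Longrightarrow> card (F n) = q ^ n"
proof -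
  assume n: "n > 0"
  define P :: "'a poly" where "P = monom 1 (q ^ n) - monom 1 1"
  have Q1: "q ^ n > 1" by (rule one_less_power[OF q_gt_1 n])
  have degP: "degree P = q ^ n"
    unfolding P_def diff_conv_add_uminus using Q1
    by (subst degree_add_eq_left) (auto simp: degree_monom_eq)
  have P0: "P \<noteq> 0"
  proof
    assume "P = 0"
    then have "q ^ n = 0" using degP by (simp only: degree_0)
    with Q1 show False by simp
  qed
  have P: "pderiv P = - 1" using n
    by (simp add: P_def pderiv_diff pderiv_monom of_nat_q_power monom_0 one_pCons del: of_nat_power)
  have roots: "{x. poly P x = 0} = F n" by (auto simp: P_def F_def poly_monom)
  show "finite (F n)" using poly_roots_finite[OF P0] roots by simp
  have ord: "order a P = 1" if "a \<in> F n" for a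
  proof -
    have "poly P a = 0" using that roots by auto
    then have ge: "order a P \<noteq> 0" using P0 by (simp add: order_root)
    have "\<not> [:-a, 1:] ^ 2 dvd P"
    proof
      assume "[:-a, 1:] ^ 2 dvd P"
      then obtain R where "P = [:-a, 1:] ^ 2 * R" by (elim dvdE)
      then have "P = [:-a, 1:] * ([:-a, 1:] * R)" by (simp only: power2_eq_square mult.assoc)
      then have "poly (pderiv P) a = 0" by (simp only: pderiv_mult) simp
      with P show False by simp
    qed
    then have "\<not> 2 \<le> order a P" by (simp add: order_divides P0)
    with ge show ?thesis by simp
  qed
  have "q ^ n = size (proots P)" by (simp add: size_proots_alg_closed degP)
  also have "\<dots> = (\<Sum>x\<in>F n. order x P)"
    by (simp add: size_multiset_overloaded_eq P0 roots)
  also have "\<dots> = card (F n)" using ord by simp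
  finally show "card (F n) = q ^ n" by simp
qed

text \<open>The power \<open>q\<close> shifts the summands of the trace cyclically, because
  \<open>x ^ (q ^ n) = x\<close>.\<close>

lemma tr_in_Fq: "x \<in> F n \<Longrightarrow> n > 0 \<Longrightarrow> tr n x \<in> Fq"
proof -
  assume x: "x \<in> F n" and n: "n > 0"
  then obtain k where k: "n = Suc k" by (cases n) auto
  have "tr n x ^ q = (\<Sum>i<n. x ^ (q ^ Suc i))"
    using power_q_sum[of "\<lambda>i. x ^ (q ^ i)" "{..<n}" 1]
    by (simp add: tr_def mult.commute flip: power_mult)
  also have "\<dots> = (\<Sum>i<k. x ^ (q ^ Suc i)) + x ^ (q ^ 0)"
    using x by (simp add: k F_def)
  also have "\<dots> = tr n x" unfolding tr_def k
    by (subst sum.lessThan_Suc_shift) simp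
  finally show ?thesis by (simp add: F_def)
qed

lemma degree_sum_q_powers:
  fixes h :: "'a poly"
  assumes "degree h > 0"
  shows "degree (\<Sum>i<Suc M. h ^ (q ^ i)) = degree h * q ^ M"
proof (induction M)
  case (Suc M)
  have "degree h * q ^ M < degree h * q ^ Suc M" using assms q_gt_1 by simp
  moreover have "degree (h ^ (q ^ Suc M)) = degree h * q ^ Suc M"
    using assms by (subst degree_power_eq) auto
  ultimately show ?case using Suc
    by (subst sum.lessThan_Suc, subst degree_add_eq_right) auto
qed (use assms in auto)

text \<open>The main term \<open>q ^ (m + M - 1)\<close> is the average size of a fibre of the
  trace. Taking \<open>q ^ m\<close>-th roots divides the degree of the auxiliary polynomial by
  \<open>q ^ m\<close>, which brings it down to this size.\<close>

lemma stepanov_bound: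
  fixes h :: "'a poly"
  assumes d: "degree h = d" "\<not> CHAR('a) dvd d"
    and m: "1 \<le> m" "m \<le> M" "d + 3 \<le> q ^ m" and a: "a \<in> Fq"
  shows "card {x \<in> F (m + M). tr (m + M) (poly h x) = a} \<le> q ^ (m + M - 1) + (2 * d + 2) * q ^ M"
proof -
  define r where "r = q ^ m"
  define b where "b = q ^ (m - 1)"
  define s where "s = q ^ (M - 1)"
  define v where "v = (\<Sum>i<m. h ^ (q ^ i))"
  define w where "w = (\<Sum>i<M. h ^ (q ^ i))"
  \<comment> \<open>\<open>i\<close> ends up in the exponent \<open>i * q ^ M\<close>, so its range
    governs the degree of \<open>W\<close>: \<open>b\<close> values account for the main term
    \<open>b * q ^ M\<close>. The further \<open>d + 2\<close> values make the unknowns outnumber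
    the coefficients of the \<open>B x\<close>.\<close>
  define A where "A = {..<b + d + 2} \<times> {..<q} \<times> {..<s}"
  have d0: "d > 0" using d(2) by (cases d) auto
  have r: "r = q * b" unfolding r_def b_def using m by (cases m) auto
  have qs: "q ^ M = q * s" unfolding s_def using m by (cases M) auto
  have sb: "b \<le> s" unfolding s_def b_def using m q_gt_1 by (intro power_increasing) auto
  have br: "b \<le> r" using r q_gt_1 by simp
  have pos: "b > 0" "s > 0" "r > 0" by (auto simp: b_def s_def r_def)
  have degv: "degree v = d * b" using degree_sum_q_powers[of h "m - 1"] d d0 m by (simp add: v_def b_def)
  have degw: "degree w = d * s" using degree_sum_q_powers[of h "M - 1"] d d0 m by (simp add: w_def s_def)
  have finA: "finite A" by (simp add: A_def)
  have cardA: "card A = (b + d + 2) * (q * s)" by (simp add: A_def)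

  define B :: "nat \<times> nat \<times> nat \<Rightarrow> 'a poly" where "B = (\<lambda>(i,j,k). monom 1 (r * k + i) * v ^ j)"
  \<comment> \<open>Of \<open>card A = r * s + (d + 2) * q ^ M\<close>, the part
    \<open>r * s\<close> covers the factor \<open>X ^ (r * k)\<close>; the rest covers
    \<open>X ^ i\<close> and \<open>v ^ j\<close>, because \<open>b <= s\<close> makes
    \<open>r\<close> at most \<open>q ^ M\<close>.\<close>
  have degB: "degree (B x) < card A - 1" if xA: "x \<in> A" for x
  proof -
    obtain i j k where x: "x = (i,j,k)" "i < b + d + 2" "j < q" "k < s" using xA by (cases x) (auto simp: A_def)
    have "degree (B x) \<le> r * k + i + degree v * j"
      unfolding B_def x using degree_mult_le[of "monom 1 (r * k + i)" "v ^ j"]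
        degree_monom_le[of "1::'a" "r * k + i"] degree_power_le[of v j] by simp
    also have "degree v * j = d * b * j" by (simp add: degv)
    finally have 1: "degree (B x) \<le> r * k + i + d * b * j" .
    have "r * Suc k \<le> r * s" using x by (intro mult_left_mono) auto
    then have 2: "r * k + r \<le> r * s" by simp
    have "d * b * j \<le> d * b * q" using x by simp
    then have 3: "d * b * j \<le> d * r" by (simp add: r mult_ac)
    have "(d + 2) * r \<le> (d + 2) * (q * s)" using sb by (intro mult_left_mono) (auto simp: r)
    moreover have "card A = r * s + (d + 2) * (q * s)" by (simp add: cardA r algebra_simps)
    ultimately have 4: "r * s + d * r + 2 * r \<le> card A" by (simp add: algebra_simps)
    have "d + 3 \<le> r" using m by (simp add: r_def)
    with 1 2 3 4 x br show ?thesis by linarith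
  qed
  obtain \<gamma> where g: "\<exists>x\<in>A. \<gamma> x \<noteq> 0" "\<forall>t\<in>{..<card A - 1}. (\<Sum>x\<in>A. coeff (B x) t * \<gamma> x) = 0"
  proof -
    have "card A > 0" using pos q_gt_1 by (simp add: cardA)
    then have "card {..<card A - 1} < card A" by simp
    from homogeneous_system_nontrivial_solution[OF _ finA this, of "\<lambda>x t. coeff (B x) t"] that
    show ?thesis by auto
  qed
  have zero: "(\<Sum>x\<in>A. smult (\<gamma> x) (B x)) = 0"
  proof (rule poly_eqI)
    fix t
    have "coeff (\<Sum>x\<in>A. smult (\<gamma> x) (B x)) t = (\<Sum>x\<in>A. coeff (B x) t * \<gamma> x)"
      by (simp add: coeff_sum mult.commute)
    also have "\<dots> = 0"
    proof (cases "t < card A - 1")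
      case False
      then have "coeff (B x) t = 0" if "x \<in> A" for x
        using degB[OF that] by (intro coeff_eq_0) auto
      then show ?thesis by simp
    qed (use g in auto)
    finally show "coeff (\<Sum>x\<in>A. smult (\<gamma> x) (B x)) t = coeff 0 t" by simp
  qed
  \<comment> \<open>\<open>W ^ r\<close> is to be the combination of the \<open>C x ^ r\<close> with
    coefficients \<open>\<gamma> x\<close>, so \<open>r\<close>-th roots of these are taken in the
    algebraically closed field.\<close>
  have "\<exists>y. y ^ r = \<gamma> x" for x using nth_root_exists[OF pos(3)] by blast
  then obtain \<delta> where \<delta>: "\<And>x. \<delta> x ^ r = \<gamma> x" by metis

  define C :: "nat \<times> nat \<times> nat \<Rightarrow> 'a poly"
    where "C = (\<lambda>(i,j,k). monom 1 (k + i * (q * s)) * ([:a:] - w) ^ j)"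
  define W where "W = (\<Sum>x\<in>A. smult (\<delta> x) (C x))"
  have degaw: "degree ([:a:] - w) = d * s"
    using degree_add_eq_right[of "[:a:]" "- w"] degw d0 pos by simp
  then have aw0: "[:a:] - w \<noteq> 0" using d0 pos by auto
  have degC: "degree (C (i,j,k)) = k + s * (i * q + j * d)" for i j k
  proof -
    have "degree (C (i,j,k)) = (k + i * (q * s)) + j * (d * s)"
      unfolding C_def using aw0 by (simp add: degree_mult_eq degree_monom_eq degree_power_eq degaw)
    then show ?thesis by (simp add: algebra_simps)
  qed
  have C0: "C x \<noteq> 0" for x using aw0 by (auto simp: C_def split: prod.splits)
  \<comment> \<open>The degree \<open>k + s * (i * q + j * d)\<close> determines
    \<open>(i, j, k)\<close>: \<open>k < s\<close> is its residue modulo \<open>s\<close>, and then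
    \<open>j < q\<close> is determined modulo \<open>q\<close> because \<open>d\<close> is prime to
    \<open>q\<close>.\<close>
  have copr: "coprime d q"
    using prime_imp_coprime[OF prime_char d(2)] unfolding q_eq
    by (metis coprime_commute coprime_power_left_iff)
  have W0: "W \<noteq> 0"
  proof -
    obtain x0 where x0: "x0 \<in> A" "\<gamma> x0 \<noteq> 0" using g by auto
    then have "\<delta> x0 \<noteq> 0" using \<delta>[of x0] pos by (metis power_eq_0_iff)
    then have 1: "smult (\<delta> x0) (C x0) \<noteq> 0" using C0 by simp
    show ?thesis unfolding W_def
    proof (rule sum_distinct_degree_nonzero[where f = "\<lambda>x. smult (\<delta> x) (C x)", OF finA x0(1) 1])
      fix x y assume xy: "x \<in> A" "y \<in> A" "smult (\<delta> x) (C x) \<noteq> 0" "smult (\<delta> y) (C y) \<noteq> 0"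
        and deg: "degree (smult (\<delta> x) (C x)) = degree (smult (\<delta> y) (C y))"
      obtain i j k where x: "x = (i,j,k)" "j < q" "k < s" using xy(1) by (auto simp: A_def)
      obtain i' j' k' where y: "y = (i',j',k')" "j' < q" "k' < s" using xy(2) by (auto simp: A_def)
      have eq: "k + s * (i * q + j * d) = k' + s * (i' * q + j' * d)"
        using deg xy(3,4) by (auto simp: x y degC)
      then have "(k + s * (i * q + j * d)) mod s = (k' + s * (i' * q + j' * d)) mod s" by simp
      then have k: "k = k'" using x y by simp
      with eq pos have eq2: "i * q + j * d = i' * q + j' * d" by simp
      then have "int i * int q + int j * int d = int i' * int q + int j' * int d"
        by (metis of_nat_add of_nat_mult)
      then have "(int j - int j') * int d = int q * (int i' - int i)" by (simp add: algebra_simps)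
      then have "int q dvd (int j - int j') * int d" by simp
      moreover have "coprime (int q) (int d)" using copr by (simp add: coprime_commute)
      ultimately have "int q dvd int j - int j'" by (simp add: coprime_dvd_mult_left_iff)
      have j: "j = j'"
      proof (rule ccontr)
        assume "j \<noteq> j'"
        then have "int q \<le> \<bar>int j - int j'\<bar>"
          using dvd_imp_le_int[OF _ \<open>int q dvd int j - int j'\<close>] by simp
        with x(2) y(2) show False by linarith
      qed
      with eq2 q_gt_1 have "i = i'" by simp
      with j k show "x = y" by (simp add: x y)
    qed
  qed
  have degW: "degree W \<le> s + s * ((b + d + 1) * q + q * d)"
    unfolding W_def
  proof (rule degree_sum_le[OF finA])
    fix x assume "x \<in> A"
    then obtain i j k where x: "x = (i,j,k)" "i < b + d + 2" "j < q" "k < s" by (auto simp: A_def)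
    have "degree (smult (\<delta> x) (C x)) \<le> k + s * (i * q + j * d)" by (simp add: x degC)
    also have "\<dots> \<le> s + s * ((b + d + 1) * q + q * d)"
      using x by (intro add_mono mult_left_mono mult_right_mono) auto
    finally show "degree (smult (\<delta> x) (C x)) \<le> s + s * ((b + d + 1) * q + q * d)" .
  qed
  have sub: "{x \<in> F (m + M). tr (m + M) (poly h x) = a} \<subseteq> {x. poly W x = 0}"
  proof safe
    fix x assume x: "x \<in> F (m + M)" and t: "a = tr (m + M) (poly h x)"
    have pr_sum: "(sum f Y :: 'a) ^ r = (\<Sum>x\<in>Y. f x ^ r)" for f and Y :: "'b set"
      unfolding r_def by (rule power_q_sum)
    \<comment> \<open>At these points the relation between the \<open>B z\<close> passes to
      \<open>W\<close>: as \<open>a ^ r = a\<close>, the trace condition reads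
      \<open>(a - w) ^ r = v\<close>, and \<open>x ^ (q ^ (m + M)) = x\<close> makes
      \<open>x ^ (q * s)\<close> an \<open>r\<close>-th root of \<open>x\<close>.\<close>
    have "poly w x ^ r = (\<Sum>i<M. poly h x ^ (q ^ (m + i)))"
      unfolding w_def poly_sum pr_sum by (simp add: r_def power_add mult.commute flip: power_mult)
    then have "a = poly v x + poly w x ^ r"
      by (simp add: t tr_def sum_lessThan_add v_def poly_sum)
    moreover have ar: "a ^ r = a" using Fq_power_q[OF a] by (simp add: r_def)
    ultimately have vw: "(a - poly w x) ^ r = poly v x"
      using power_q_diff[of a "poly w x" m] by (simp add: r_def)
    have xr: "(x ^ (q * s)) ^ r = x"
      using x by (simp add: F_def r_def power_add mult.commute flip: power_mult qs)
    have "poly W x ^ r = (\<Sum>z\<in>A. (\<delta> z * poly (C z) x) ^ r)"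
      unfolding W_def poly_sum pr_sum by simp
    also have "\<dots> = (\<Sum>z\<in>A. \<gamma> z * poly (B z) x)"
    proof (rule sum.cong[OF refl])
      fix z assume "z \<in> A"
      obtain i j k where z: "z = (i,j,k)" by (cases z)
      have "poly (C z) x ^ r = (x ^ k) ^ r * ((x ^ (q * s)) ^ i) ^ r * ((a - poly w x) ^ j) ^ r"
        by (simp add: z C_def poly_monom power_add power_mult_distrib mult.commute[of i] power_mult)
      also have "((x ^ (q * s)) ^ i) ^ r = ((x ^ (q * s)) ^ r) ^ i"
        by (simp add: mult_ac flip: power_mult)
      also have "((a - poly w x) ^ j) ^ r = ((a - poly w x) ^ r) ^ j"
        by (simp add: mult_ac flip: power_mult)
      also have "(x ^ k) ^ r * ((x ^ (q * s)) ^ r) ^ i * ((a - poly w x) ^ r) ^ j = poly (B z) x"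
        unfolding xr vw by (simp add: z B_def poly_monom power_add mult.commute[of r] power_mult)
      finally show "(\<delta> z * poly (C z) x) ^ r = \<gamma> z * poly (B z) x"
        by (simp add: power_mult_distrib \<delta>)
    qed
    also have "\<dots> = poly (\<Sum>z\<in>A. smult (\<gamma> z) (B z)) x" by (simp add: poly_sum)
    also have "\<dots> = 0" by (simp add: zero)
    finally show "poly W x = 0" by simp
  qed
  have "card {x \<in> F (m + M). tr (m + M) (poly h x) = a} \<le> card {x. poly W x = 0}"
    using sub by (intro card_mono poly_roots_finite W0)
  also have "\<dots> \<le> degree W" by (rule card_poly_roots_bound[OF W0])
  also have "\<dots> \<le> b * (q * s) + (2 * d + 2) * (q * s)"
  proof -
    have "s \<le> q * s" using q_gt_1 by simp
    moreover have "s + s * ((b + d + 1) * q + q * d) = s + q * s + b * (q * s) + 2 * (d * (q * s))"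
      by (simp add: algebra_simps)
    moreover have "(2 * d + 2) * (q * s) = 2 * (d * (q * s)) + 2 * (q * s)"
      by (simp add: algebra_simps)
    ultimately show ?thesis using degW by linarith
  qed
  also have "b * (q * s) = q ^ (m + M - 1)"
    using m unfolding b_def qs[symmetric] power_add[symmetric] by simp
  finally show ?thesis by (simp add: qs)
qed

end

section \<open>The L-function of an additive character\<close>

lemma coeff_reflect_prod_linear:
  fixes A :: "'a::idom multiset"
  assumes "k \<le> size A"
  shows "coeff (\<Prod>x\<in>#A. [:1, -x:]) k = coeff (\<Prod>x\<in>#A. [:-x, 1:]) (size A - k)"
proof -
  have "reflect_poly (\<Prod>x\<in>#A. [:-x, 1:]) = (\<Prod>x\<in>#A. [:1, -x:])"
  proof (induction A)
    case (add x A)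
    have "reflect_poly [:-x, 1:] = [:1, -x:]"
      by (rule poly_eqI) (auto simp: coeff_reflect_poly coeff_pCons split: nat.splits)
    then show ?case by (simp only: image_mset_add_mset prod_mset.add_mset reflect_poly_mult add)
  qed auto
  moreover have "degree (\<Prod>x\<in>#A. [:-x, 1:]) = size A"
  proof (induction A)
    case (add x A)
    have "(\<Prod>x\<in>#A. [:-x, 1:]) \<noteq> 0" by auto
    then show ?case unfolding image_mset_add_mset prod_mset.add_mset
      by (subst degree_mult_eq) (auto simp: add)
  qed auto
  ultimately show ?thesis using assms by (metis coeff_reflect_poly leD)
qed

text \<open>This is the logarithmic derivative of the product, cleared of denominators: the factor
  \<open>1 - a * X\<close> contributes minus the geometric series \<open>?H\<close>, for which
  \<open>(1 - a * X) * ?H = a * X\<close>.\<close>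

lemma newton_identity_fps:
  fixes A :: "'a::idom multiset"
  defines "E \<equiv> fps_of_poly (\<Prod>x\<in>#A. [:1, -x:])"
  defines "G \<equiv> Abs_fps (\<lambda>k. if k = 0 then 0 else (\<Sum>x\<in>#A. x ^ k))"
  shows "fps_X * fps_deriv E = - (E * G)"
  unfolding E_def G_def
proof (induction A)
  case empty
  then show ?case by (simp add: fps_eq_iff)
next
  case (add a A)
  let ?E = "fps_of_poly (\<Prod>x\<in>#A. [:1, -x:])"
  let ?G = "Abs_fps (\<lambda>k. if k = 0 then 0 else (\<Sum>x\<in>#A. x ^ k))"
  let ?L = "1 - fps_const a * fps_X :: 'a fps"
  let ?H = "Abs_fps (\<lambda>k. if k = 0 then 0 else a ^ k)"
  have L: "fps_of_poly [:1, -a:] = ?L"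
    by (simp add: fps_of_poly_pCons fps_eq_iff)
  have H: "?L * ?H = fps_const a * fps_X"
  proof (rule fps_ext)
    fix n
    have "(?L * ?H) $ n = ?H $ n - a * (fps_X * ?H) $ n"
      by (simp add: algebra_simps)
    also have "\<dots> = (fps_const a * fps_X) $ n"
      by (cases n) (auto simp: power_0_left)
    finally show "(?L * ?H) $ n = (fps_const a * fps_X) $ n" .
  qed
  have G: "Abs_fps (\<lambda>k. if k = 0 then 0 else (\<Sum>x\<in>#add_mset a A. x ^ k)) = ?H + ?G"
    by (auto simp: fps_eq_iff)
  have "fps_X * fps_deriv (?L * ?E) = ?L * (fps_X * fps_deriv ?E) - fps_X * fps_const a * ?E"
    by (simp add: algebra_simps)
  also have "\<dots> = - (?L * ?E * ?G) - ?L * ?H * ?E"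
    unfolding add H by (simp add: algebra_simps)
  also have "\<dots> = - (?L * ?E * (?H + ?G))"
    by (simp add: algebra_simps)
  finally show ?case
    unfolding G by (simp only: image_mset_add_mset prod_mset.add_mset fps_of_poly_mult L)
qed

lemma newton_identity:
  fixes A :: "'a::idom multiset"
  assumes "k > 0"
  shows "(\<Sum>x\<in>#A. x ^ k) = - (of_nat k * coeff (\<Prod>x\<in>#A. [:1, -x:]) k)
           - (\<Sum>i = 1..<k. coeff (\<Prod>x\<in>#A. [:1, -x:]) i * (\<Sum>x\<in>#A. x ^ (k - i)))"
proof -
  let ?Q = "\<Prod>x\<in>#A. [:1, -x:]"
  define G where "G = (\<lambda>k. if k = 0 then 0 else (\<Sum>x\<in>#A. x ^ k))"
  obtain l where l: "k = Suc l" using assms by (cases k) auto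
  have Q0: "coeff ?Q 0 = 1" by (induction A) (auto simp: coeff_mult)
  have "of_nat k * coeff ?Q k = (fps_X * fps_deriv (fps_of_poly ?Q)) $ k"
    by (simp add: l)
  also have "\<dots> = - (\<Sum>i=0..k. coeff ?Q i * G (k - i))"
    unfolding newton_identity_fps by (simp add: fps_mult_nth G_def)
  also have "(\<Sum>i=0..k. coeff ?Q i * G (k - i)) = G k + (\<Sum>i=1..<k. coeff ?Q i * G (k - i))"
  proof -
    have "{0..k} = insert 0 (insert k {1..<k})" using assms by auto
    then show ?thesis using assms by (simp add: Q0 G_def)
  qed
  also have "(\<Sum>i=1..<k. coeff ?Q i * G (k - i)) = (\<Sum>i=1..<k. coeff ?Q i * (\<Sum>x\<in>#A. x ^ (k - i)))"
    by (intro sum.cong) (auto simp: G_def)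
  finally have eq: "of_nat k * coeff ?Q k =
      - ((\<Sum>x\<in>#A. x ^ k) + (\<Sum>i=1..<k. coeff ?Q i * (\<Sum>x\<in>#A. x ^ (k - i))))"
    using assms by (simp add: G_def)
  show ?thesis unfolding eq by simp
qed

text \<open>Newton's identities are triangular: coefficient \<open>k\<close> enters power sum
  \<open>k\<close> only through the term \<open>- k * coeff _ k\<close>. A change in coefficient
  \<open>d\<close> is thus first felt, and linearly, by power sum \<open>d\<close>.\<close>

lemma power_sums_perturb:
  fixes A B :: "'a::idom multiset"
  assumes eq: "\<And>i. i < d \<Longrightarrow> coeff (\<Prod>x\<in>#A. [:1, -x:]) i = coeff (\<Prod>x\<in>#B. [:1, -x:]) i"
  shows "0 < k \<Longrightarrow> k < d \<Longrightarrow> (\<Sum>x\<in>#A. x ^ k) = (\<Sum>x\<in>#B. x ^ k)"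
    and "0 < d \<Longrightarrow> (\<Sum>x\<in>#A. x ^ d) - (\<Sum>x\<in>#B. x ^ d) =
      - (of_nat d * (coeff (\<Prod>x\<in>#A. [:1, -x:]) d - coeff (\<Prod>x\<in>#B. [:1, -x:]) d))"
proof -
  show 1: "(\<Sum>x\<in>#A. x ^ k) = (\<Sum>x\<in>#B. x ^ k)" if "0 < k" "k < d" for k
    using that
  proof (induction k rule: less_induct)
    case (less k)
    have "(\<Sum>i = 1..<k. coeff (\<Prod>x\<in>#A. [:1, -x:]) i * (\<Sum>x\<in>#A. x ^ (k - i)))
        = (\<Sum>i = 1..<k. coeff (\<Prod>x\<in>#B. [:1, -x:]) i * (\<Sum>x\<in>#B. x ^ (k - i)))"
      using less eq by (intro sum.cong) auto
    then show ?case
      unfolding newton_identity[OF less.prems(1)] using eq less.prems by simp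
  qed
  assume d: "0 < d"
  have "(\<Sum>i = 1..<d. coeff (\<Prod>x\<in>#A. [:1, -x:]) i * (\<Sum>x\<in>#A. x ^ (d - i)))
      = (\<Sum>i = 1..<d. coeff (\<Prod>x\<in>#B. [:1, -x:]) i * (\<Sum>x\<in>#B. x ^ (d - i)))"
    using eq 1 by (intro sum.cong) auto
  then show "(\<Sum>x\<in>#A. x ^ d) - (\<Sum>x\<in>#B. x ^ d) =
      - (of_nat d * (coeff (\<Prod>x\<in>#A. [:1, -x:]) d - coeff (\<Prod>x\<in>#B. [:1, -x:]) d))"
    unfolding newton_identity[OF d] by (simp add: algebra_simps)
qed

lemma dvd_if_order_le:
  fixes C P :: "'a::alg_closed_field poly"
  assumes "lead_coeff C = 1" "lead_coeff P = 1" "\<And>y. order y C \<le> order y P"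
  shows "C dvd P"
proof -
  have "C \<noteq> 0" "P \<noteq> 0" using assms by auto
  then have "proots C \<subseteq># proots P" using assms by (auto simp: subseteq_mset_def)
  then have "(\<Prod>x\<in>#proots C. [:-x, 1:]) dvd (\<Prod>x\<in>#proots P. [:-x, 1:])"
    by (intro prod_mset_subset_imp_dvd image_mset_subseteq_mono)
  then show ?thesis using assms monic_eq_prod_proots by metis
qed

section \<open>Polynomials over \<open>Fq\<close> and Frobenius orbits\<close>

context finite_subfields begin

definition F_poly :: "'a poly \<Rightarrow> bool" where "F_poly P \<longleftrightarrow> (\<forall>i. coeff P i \<in> Fq)"

definition frob :: "'a poly \<Rightarrow> 'a poly" where "frob P = map_poly (\<lambda>x. x ^ q) P"

lemma coeff_frob [simp]: "coeff (frob P) i = coeff P i ^ q"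
  by (simp add: frob_def coeff_map_poly)

lemma power_q_sum1: "(sum f A :: 'a) ^ q = (\<Sum>x\<in>A. f x ^ q)"
  using power_q_sum[of f A 1] by simp

text \<open>As a fixed-point equation, having coefficients in \<open>Fq\<close> passes to products
  and cofactors by the multiplicativity of \<open>frob\<close>.\<close>

lemma F_poly_iff: "F_poly P \<longleftrightarrow> frob P = P"
  by (auto simp: F_poly_def F_def poly_eq_iff)

lemma frob_mult: "frob (P * R) = frob P * frob R"
  by (rule poly_eqI) (simp add: coeff_mult power_q_sum1 power_mult_distrib)

lemma frob_1 [simp]: "frob 1 = 1"
  by (rule poly_eqI) (auto simp: coeff_1)

lemma frob_prod: "frob (prod f A) = (\<Prod>x\<in>A. frob (f x))"
  by (induction A rule: infinite_finite_induct) (auto simp: frob_mult)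

lemma frob_power: "frob (P ^ n) = frob P ^ n"
  by (induction n) (auto simp: frob_mult)

lemma frob_linear: "frob [:-x, 1:] = [:-(x ^ q), 1:]"
  using power_q_minus[of x 1] by (intro poly_eqI) (auto simp: coeff_pCons split: nat.splits)

lemma poly_frob: "poly (frob P) (x ^ q) = poly P x ^ q"
proof (induction P)
  case (pCons a P)
  have "frob (pCons a P) = pCons (a ^ q) (frob P)"
    by (rule poly_eqI) (simp add: coeff_pCons split: nat.splits)
  then show ?case using pCons power_q_add[of a "x * poly P x" 1]
    by (simp add: power_mult_distrib)
qed (simp add: frob_def zero_power)

lemma F_poly_mult: "F_poly P \<Longrightarrow> F_poly R \<Longrightarrow> F_poly (P * R)"
  by (simp add: F_poly_iff frob_mult)

lemma F_poly_add: "F_poly P \<Longrightarrow> F_poly R \<Longrightarrow> F_poly (P + R)"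
  by (simp add: F_poly_def F_add)

lemma F_poly_monom: "c \<in> Fq \<Longrightarrow> F_poly (monom c n)"
  by (simp add: F_poly_def F_0)

lemma F_poly_cofactor:
  assumes "F_poly (C * R)" "F_poly C" "C \<noteq> 0"
  shows "F_poly R"
proof -
  have "C * frob R = C * R" using assms by (simp add: F_poly_iff frob_mult)
  then show ?thesis using assms by (simp add: F_poly_iff)
qed

lemma poly_power_q: "F_poly P \<Longrightarrow> poly P (x ^ (q ^ i)) = poly P x ^ (q ^ i)"
proof (induction i)
  case (Suc i)
  then show ?case using poly_frob[of P "x ^ (q ^ i)"]
    by (simp add: F_poly_iff mult.commute[of q] power_mult)
qed auto

text \<open>\<open>frob\<close> turns the factorisation \<open>P = (X - x) ^ n * R\<close> into one
  at \<open>x ^ q\<close> with the same exponent, and \<open>frob R\<close> takes the nonzero value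
  \<open>poly R x ^ q\<close> there.\<close>

lemma order_frob:
  assumes "F_poly P" "P \<noteq> 0"
  shows "order (x ^ q) P = order x P"
proof -
  obtain R where R: "P = [:-x, 1:] ^ order x P * R" "\<not> [:-x, 1:] dvd R"
    using order_decomp[OF assms(2)] by blast
  have "P = frob ([:-x, 1:] ^ order x P * R)"
    using assms(1) R(1) by (simp add: F_poly_iff)
  then have P: "P = [:-(x ^ q), 1:] ^ order x P * frob R"
    by (simp only: frob_mult frob_power frob_linear)
  have "poly R x \<noteq> 0" using R(2) by (simp add: poly_eq_0_iff_dvd)
  then have "poly (frob R) (x ^ q) \<noteq> 0" by (simp add: poly_frob)
  then have "order (x ^ q) (frob R) = 0" by (rule order_0I)
  moreover have "order (x ^ q) P = order (x ^ q) ([:-(x ^ q), 1:] ^ order x P) + order (x ^ q) (frob R)"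
    using P assms(2) by (metis order_mult)
  ultimately show ?thesis by (simp add: order_power_n_n)
qed

lemma order_frob_power:
  assumes "F_poly P" "P \<noteq> 0"
  shows "order (x ^ (q ^ i)) P = order x P"
proof (induction i)
  case (Suc i)
  have "order (x ^ (q ^ Suc i)) P = order ((x ^ (q ^ i)) ^ q) P"
    by (simp add: mult.commute flip: power_mult)
  then show ?case using order_frob[OF assms] Suc by simp
qed auto

lemma image_proots_frob:
  assumes "F_poly P" "P \<noteq> 0"
  shows "image_mset (\<lambda>x. x ^ q) (proots P) = proots P"
proof (rule multiset_eqI)
  fix y :: 'a
  obtain x where x: "y = x ^ q" using nth_root_exists[of q y] by auto
  have "(\<lambda>x. x ^ q) -` {x ^ q} = {x}" using power_q_inj[of _ 1] by auto
  then have "count (image_mset (\<lambda>x. x ^ q) (proots P)) y = count (proots P) x"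
    unfolding x count_image_mset by (cases "x \<in># proots P") (auto simp: not_in_iff)
  then show "count (image_mset (\<lambda>x. x ^ q) (proots P)) y = count (proots P) y"
    using assms by (simp add: order_frob x)
qed

text \<open>For \<open>x\<close> in \<open>F k\<close> with \<open>k > 0\<close> this is the
  characteristic polynomial of \<open>x\<close> over \<open>Fq\<close>, a power of its minimal
  polynomial.\<close>

definition orbit_poly :: "nat \<Rightarrow> 'a \<Rightarrow> 'a poly" where
  "orbit_poly k x = (\<Prod>i<k. [:- (x ^ (q ^ i)), 1:])"

lemma orbit_poly_nonzero: "orbit_poly k x \<noteq> 0"
  by (simp add: orbit_poly_def)

lemma degree_orbit_poly: "degree (orbit_poly k x) = k"
  unfolding orbit_poly_def by (subst degree_prod_sum_eq) auto

lemma lead_coeff_orbit_poly: "lead_coeff (orbit_poly k x) = 1"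
  unfolding orbit_poly_def lead_coeff_prod by simp

lemma proots_orbit_poly: "proots (orbit_poly k x) = image_mset (\<lambda>i. x ^ (q ^ i)) (mset_set {..<k})"
proof -
  have "proots (orbit_poly k x) = (\<Sum>i<k. {#x ^ (q ^ i)#})"
    unfolding orbit_poly_def by (subst proots_prod) auto
  also have "\<dots> = image_mset (\<lambda>i. x ^ (q ^ i)) (mset_set {..<k})"
    by (induction k) (auto simp: lessThan_Suc)
  finally show ?thesis .
qed

lemma order_orbit_poly: "order y (orbit_poly k x) = card {i. i < k \<and> x ^ (q ^ i) = y}"
proof -
  have "order y (orbit_poly k x) = count (image_mset (\<lambda>i. x ^ (q ^ i)) (mset_set {..<k})) y"
    unfolding proots_orbit_poly[symmetric] by (simp add: orbit_poly_nonzero)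
  also have "\<dots> = card {i. i < k \<and> x ^ (q ^ i) = y}"
    by (simp add: count_image_mset' sum.If_cases Int_def conj_commute eq_commute)
  finally show ?thesis .
qed

lemma F_poly_orbit_poly:
  assumes "x \<in> F k"
  shows "F_poly (orbit_poly k x)"
proof (cases k)
  case (Suc l)
  have "frob (orbit_poly k x) = (\<Prod>i<k. [:- (x ^ (q ^ Suc i)), 1:])"
    unfolding orbit_poly_def frob_prod frob_linear by (simp add: mult.commute flip: power_mult)
  also have "\<dots> = (\<Prod>i<l. [:- (x ^ (q ^ Suc i)), 1:]) * [:- (x ^ (q ^ 0)), 1:]"
    using assms unfolding Suc by (subst prod.lessThan_Suc) (simp add: F_def)
  also have "\<dots> = orbit_poly k x"
    unfolding orbit_poly_def Suc by (subst prod.lessThan_Suc_shift) simp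
  finally show ?thesis by (simp add: F_poly_iff)
qed (simp add: orbit_poly_def F_poly_iff)

lemma F_add_iff: "x \<in> F m \<Longrightarrow> x \<in> F (m + n) \<longleftrightarrow> x \<in> F n"
  by (simp add: F_def power_add power_mult)

lemma F_mult_nat: "x \<in> F m \<Longrightarrow> x \<in> F (t * m)"
  by (induction t) (auto simp: F_add_iff, simp add: F_def)

text \<open>Let \<open>\<delta>\<close> be the degree of \<open>x\<close> over \<open>Fq\<close>.
  Then \<open>x\<close> lies in \<open>F k\<close> exactly when \<open>\<delta>\<close> divides
  \<open>k\<close>, and \<open>orbit_poly (t * \<delta>) x\<close> is the \<open>t\<close>-th power
  of the minimal polynomial, so it divides \<open>P\<close> exactly for \<open>t\<close> up to the
  multiplicity of \<open>x\<close>.\<close>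

lemma order_eq_card_orbit_dvd:
  assumes P: "F_poly P" "lead_coeff P = 1" and x: "poly P x = 0"
  shows "order x P = card {k \<in> {1..degree P}. x \<in> F k \<and> orbit_poly k x dvd P}"
proof -
  have P0: "P \<noteq> 0" using P by auto
  \<comment> \<open>All conjugates of \<open>x\<close> are roots of \<open>P\<close>, so two of them
    coincide; by injectivity of Frobenius, \<open>x\<close> itself lies in some \<open>F k\<close>
    with \<open>k > 0\<close>.\<close>
  have "finite (range (\<lambda>i. x ^ (q ^ i)))"
    by (rule finite_subset[OF _ poly_roots_finite[OF P0]]) (auto simp: poly_power_q P x)
  then have "\<not> inj (\<lambda>i::nat. x ^ (q ^ i))" using finite_imageD infinite_UNIV_nat by blast
  then obtain i j where "i < j" "x ^ (q ^ i) = x ^ (q ^ j)"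
    unfolding inj_def by (metis linorder_neqE_nat)
  then have "x ^ (q ^ i) = (x ^ (q ^ (j - i))) ^ (q ^ i)"
    by (simp flip: power_mult power_add)
  then have "x ^ (q ^ (j - i)) = x" by (simp add: power_q_inj)
  then have ex: "\<exists>k. 0 < k \<and> x \<in> F k" using \<open>i < j\<close> by (intro exI[of _ "j - i"]) (auto simp: F_def)
  define \<delta> where "\<delta> = (LEAST k. 0 < k \<and> x \<in> F k)"
  have \<delta>: "0 < \<delta>" "x \<in> F \<delta>" using LeastI_ex[OF ex] by (auto simp: \<delta>_def)
  have F_iff: "x \<in> F k \<longleftrightarrow> \<delta> dvd k" for k
  proof -
    have "x \<in> F (k div \<delta> * \<delta> + k mod \<delta>) \<longleftrightarrow> x \<in> F (k mod \<delta>)"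
      by (rule F_add_iff[OF F_mult_nat[OF \<delta>(2)]])
    also have "\<dots> \<longleftrightarrow> k mod \<delta> = 0"
    proof (cases "k mod \<delta> = 0")
      case True
      then show ?thesis by (simp add: F_def)
    next
      case False
      have "k mod \<delta> < \<delta>" using \<delta>(1) by simp
      then show ?thesis using not_less_Least[of "k mod \<delta>" "\<lambda>k. 0 < k \<and> x \<in> F k"] False
        unfolding \<delta>_def[symmetric] by auto
    qed
    finally show ?thesis by (simp add: dvd_eq_mod_eq_0)
  qed
  have ord: "order x (orbit_poly (t * \<delta>) x) = t" for t
  proof -
    have "{i. i < t * \<delta> \<and> x ^ (q ^ i) = x} = (\<lambda>j. j * \<delta>) ` {..<t}"
    proof -
      have "{i. i < t * \<delta> \<and> x ^ (q ^ i) = x} = {i. i < t * \<delta> \<and> \<delta> dvd i}"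
        using F_iff by (auto simp: F_def)
      also have "\<dots> = (\<lambda>j. j * \<delta>) ` {..<t}" using \<delta>(1) by (auto simp: dvd_def mult.commute)
      finally show ?thesis .
    qed
    then show ?thesis using \<delta>(1) by (simp add: order_orbit_poly card_image inj_on_def)
  qed
  have dvd_iff: "orbit_poly (t * \<delta>) x dvd P \<longleftrightarrow> t \<le> order x P" for t
  proof
    assume "orbit_poly (t * \<delta>) x dvd P"
    then have "order x (orbit_poly (t * \<delta>) x) \<le> order x P" using P0 by (rule dvd_imp_order_le[rotated])
    then show "t \<le> order x P" by (simp add: ord)
  next
    assume t: "t \<le> order x P"
    let ?C = "orbit_poly (t * \<delta>) x"
    show "?C dvd P"
    proof (rule dvd_if_order_le[OF lead_coeff_orbit_poly P(2)])
      fix y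
      show "order y ?C \<le> order y P"
      proof (cases "\<exists>i. x ^ (q ^ i) = y")
        case True
        then obtain i where y: "y = x ^ (q ^ i)" by auto
        have "F_poly ?C" by (rule F_poly_orbit_poly) (simp add: F_iff)
        then show ?thesis unfolding y
          using t P P0 orbit_poly_nonzero by (simp add: order_frob_power ord)
      next
        case False
        then show ?thesis by (auto simp: order_orbit_poly)
      qed
    qed
  qed
  have "{k \<in> {1..degree P}. x \<in> F k \<and> orbit_poly k x dvd P} = (\<lambda>t. t * \<delta>) ` {1..order x P}"
  proof safe
    fix k assume k: "k \<in> {1..degree P}" "x \<in> F k" "orbit_poly k x dvd P"
    then obtain t where t: "k = t * \<delta>" using F_iff by (auto simp: dvd_def mult.commute)
    have "t \<le> order x P" using dvd_iff[of t] k(3) t by simp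
    moreover have "t \<noteq> 0" using k(1) t by (intro notI) simp
    ultimately have "t \<in> {1..order x P}" by simp
    then show "k \<in> (\<lambda>t. t * \<delta>) ` {1..order x P}" using t by blast
  next
    fix t assume t: "t \<in> {1..order x P}"
    then show dv: "orbit_poly (t * \<delta>) x dvd P" using dvd_iff by auto
    show "x \<in> F (t * \<delta>)" by (simp add: F_iff)
    have "t * \<delta> \<le> degree P" using dvd_imp_degree_le[OF dv P0] by (simp add: degree_orbit_poly)
    then show "t * \<delta> \<in> {1..degree P}" using t \<delta> by auto
  qed
  then show ?thesis using \<delta>(1) by (simp add: card_image inj_on_def)
qed

text \<open>Both sides count the roots of \<open>P\<close> with multiplicity, the right one as pairs
  \<open>(k, x)\<close> grouped by \<open>k\<close>.\<close>

lemma degree_eq_sum_orbit_dvd: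
  assumes P: "F_poly P" "lead_coeff P = 1"
  shows "degree P = (\<Sum>k=1..degree P. card {x \<in> F k. orbit_poly k x dvd P})"
proof -
  have P0: "P \<noteq> 0" using P by auto
  let ?R = "{x. poly P x = 0}"
  have finR: "finite ?R" by (rule poly_roots_finite[OF P0])
  have "degree P = (\<Sum>x\<in>?R. order x P)"
    using size_proots_alg_closed[of P] by (simp add: size_multiset_overloaded_eq P0)
  also have "\<dots> = (\<Sum>x\<in>?R. card {k \<in> {1..degree P}. x \<in> F k \<and> orbit_poly k x dvd P})"
    using P by (intro sum.cong order_eq_card_orbit_dvd) auto
  also have "\<dots> = (\<Sum>x\<in>?R. \<Sum>k=1..degree P. if x \<in> F k \<and> orbit_poly k x dvd P then 1 else 0)"
    by (simp add: sum.If_cases Int_def)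
  also have "\<dots> = (\<Sum>k=1..degree P. \<Sum>x\<in>?R. if x \<in> F k \<and> orbit_poly k x dvd P then 1 else 0)"
    by (rule sum.swap)
  also have "\<dots> = (\<Sum>k=1..degree P. card {x \<in> F k. orbit_poly k x dvd P})"
  proof (rule sum.cong[OF refl])
    fix k assume k: "k \<in> {1..degree P}"
    have "poly P x = 0" if "orbit_poly k x dvd P" for x
    proof -
      have "[:- (x ^ (q ^ 0)), 1:] dvd orbit_poly k x" unfolding orbit_poly_def
        using k by (intro dvd_prodI) auto
      then show ?thesis using that by (simp add: poly_eq_0_iff_dvd dvd_trans)
    qed
    then have "?R \<inter> {x. x \<in> F k \<and> orbit_poly k x dvd P} = {x \<in> F k. orbit_poly k x dvd P}" by auto
    then show "(\<Sum>x\<in>?R. if x \<in> F k \<and> orbit_poly k x dvd P then 1 else 0)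
        = card {x \<in> F k. orbit_poly k x dvd P}"
      using finR by (simp add: sum.If_cases)
  qed
  finally show ?thesis .
qed

definition monic_polys :: "nat \<Rightarrow> 'a poly set" where
  "monic_polys n = {P. degree P = n \<and> lead_coeff P = 1 \<and> F_poly P}"

lemma finite_monic_polys: "finite (monic_polys n)"
proof (rule finite_subset)
  show "monic_polys n \<subseteq> Poly ` {xs. set xs \<subseteq> Fq \<and> length xs = Suc n}"
  proof
    fix P assume P: "P \<in> monic_polys n"
    then have "P \<noteq> 0" by (auto simp: monic_polys_def)
    then have "length (coeffs P) = Suc n" using P by (simp add: length_coeffs_degree monic_polys_def)
    moreover have "set (coeffs P) \<subseteq> Fq" using P by (auto simp: monic_polys_def F_poly_def coeffs_def)
    moreover have "P = Poly (coeffs P)" by simp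
    ultimately show "P \<in> Poly ` {xs. set xs \<subseteq> Fq \<and> length xs = Suc n}" by blast
  qed
  show "finite (Poly ` {xs. set xs \<subseteq> Fq \<and> length xs = Suc n})"
    by (intro finite_imageI finite_lists_length_eq finite_F) auto
qed

lemma monic_polys_0: "monic_polys 0 = {1}"
proof -
  have "P = 1" if "degree P = 0" "lead_coeff P = 1" for P :: "'a poly"
    using that by (metis degree_eq_zeroE lead_coeff_pCons(2) one_pCons)
  then show ?thesis by (auto simp: monic_polys_def F_poly_iff)
qed

end

section \<open>The L-function of \<open>\<psi>\<close> and \<open>h\<close>\<close>

locale additive_character_sum = finite_subfields q e K for q e and K :: "'a::alg_closed_field itself" +
  fixes \<psi> :: "'a \<Rightarrow> complex" and h :: "'a poly"
  assumes psi_add: "x \<in> Fq \<Longrightarrow> y \<in> Fq \<Longrightarrow> \<psi> (x + y) = \<psi> x * \<psi> y"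
    and psi_norm: "x \<in> Fq \<Longrightarrow> norm (\<psi> x) = 1"
    and psi_nontrivial: "\<exists>x\<in>Fq. \<psi> x \<noteq> 1"
    and h_F: "F_poly h"
    and deg_h: "\<not> CHAR('a) dvd degree h"
begin

text \<open>\<open>\<psi> (tot P)\<close> is completely multiplicative in the monic \<open>P\<close>
  over \<open>Fq\<close>, like a Dirichlet character; on the orbit polynomial of \<open>x\<close> in
  \<open>F k\<close> it gives the summand of \<open>ext_sum k\<close> at \<open>x\<close>.\<close>

definition tot :: "'a poly \<Rightarrow> 'a" where "tot P = (\<Sum>x\<in>#proots P. poly h x)"

definition ext_sum :: "nat \<Rightarrow> complex" where "ext_sum k = (\<Sum>x\<in>F k. \<psi> (tr k (poly h x)))"

text \<open>The coefficient of \<open>T ^ n\<close> in the L-function, the sum of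
  \<open>\<psi> (tot P) * T ^ degree P\<close> over all monic \<open>P\<close>.\<close>

definition L_coeff :: "nat \<Rightarrow> complex" where "L_coeff n = (\<Sum>P\<in>monic_polys n. \<psi> (tot P))"

lemma psi_0: "\<psi> 0 = 1"
proof -
  have "\<psi> 0 = \<psi> 0 * \<psi> 0" using psi_add[of 0 0] F_0 by simp
  moreover have "\<psi> 0 \<noteq> 0" using psi_norm[OF F_0] by auto
  ultimately show ?thesis by simp
qed

lemma sum_psi: "(\<Sum>x\<in>Fq. \<psi> x) = 0"
proof -
  obtain c where c: "c \<in> Fq" "\<psi> c \<noteq> 1" using psi_nontrivial by auto
  have "(\<Sum>x\<in>Fq. \<psi> x) = (\<Sum>x\<in>Fq. \<psi> (c + x))"
    by (rule sum.reindex_bij_witness[of _ "\<lambda>x. c + x" "\<lambda>x. x - c"]) (auto intro: F_add F_diff c)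
  also have "\<dots> = \<psi> c * (\<Sum>x\<in>Fq. \<psi> x)"
    using c by (simp add: psi_add sum_distrib_left)
  finally show ?thesis using c by simp
qed

lemma tot_in_F: "F_poly P \<Longrightarrow> P \<noteq> 0 \<Longrightarrow> tot P \<in> Fq"
proof -
  assume P: "F_poly P" "P \<noteq> 0"
  have pq: "(\<Sum>x\<in>#A. poly h x) ^ q = (\<Sum>x\<in>#A. poly h x ^ q)" for A
    by (induction A) (use power_q_add[of _ _ 1] in \<open>auto simp: zero_power\<close>)
  have "tot P ^ q = (\<Sum>x\<in>#proots P. poly h (x ^ q))"
    unfolding tot_def pq using poly_power_q[OF h_F, of _ 1] by simp
  also have "\<dots> = (\<Sum>x\<in>#image_mset (\<lambda>x. x ^ q) (proots P). poly h x)"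
    by (simp add: image_mset.compositionality comp_def)
  also have "\<dots> = tot P" by (simp add: image_proots_frob P tot_def)
  finally show ?thesis by (simp add: F_def)
qed

lemma tot_mult: "P \<noteq> 0 \<Longrightarrow> R \<noteq> 0 \<Longrightarrow> tot (P * R) = tot P + tot R"
  by (simp add: tot_def proots_mult)

lemma tot_orbit_poly: "tot (orbit_poly k x) = tr k (poly h x)"
  by (simp add: tot_def proots_orbit_poly tr_def poly_power_q[OF h_F] image_mset.compositionality
      comp_def sum_unfold_sum_mset)

lemma L_coeff_0: "L_coeff 0 = 1"
  by (simp add: L_coeff_def monic_polys_0 tot_def psi_0)

lemma sum_multiples:
  assumes C: "C \<in> monic_polys k" and k: "k \<le> n"
  shows "(\<Sum>P\<in>{P \<in> monic_polys n. C dvd P}. \<psi> (tot P)) = \<psi> (tot C) * L_coeff (n - k)"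
proof -
  have C0: "C \<noteq> 0" and CF: "F_poly C" using C by (auto simp: monic_polys_def)
  have nz: "R \<noteq> 0" if "R \<in> monic_polys m" for R m using that by (auto simp: monic_polys_def)
  have "(\<Sum>P\<in>{P \<in> monic_polys n. C dvd P}. \<psi> (tot P)) = (\<Sum>R\<in>monic_polys (n - k). \<psi> (tot (C * R)))"
  proof (rule sum.reindex_bij_witness[of _ "\<lambda>R. C * R" "\<lambda>P. P div C"])
    fix P assume P: "P \<in> {P \<in> monic_polys n. C dvd P}"
    then obtain R where R: "P = C * R" by (auto elim: dvdE)
    then have PR: "P div C = R" using C0 by simp
    have R0: "R \<noteq> 0" using nz[of P n] P R by auto
    show "C * (P div C) = P" "\<psi> (tot (C * (P div C))) = \<psi> (tot P)" using PR R by auto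
    have "F_poly R" using F_poly_cofactor[of C R] P R C0 CF by (simp add: monic_polys_def)
    moreover have "degree P = degree C + degree R" using C0 R0 by (simp add: R degree_mult_eq)
    then have "degree R = n - k" using P C by (auto simp: monic_polys_def)
    moreover have "lead_coeff P = lead_coeff C * lead_coeff R" by (simp only: R lead_coeff_mult)
    then have "lead_coeff R = 1" using P C by (auto simp: monic_polys_def)
    ultimately show "P div C \<in> monic_polys (n - k)" by (simp add: PR monic_polys_def)
  next
    fix R assume R: "R \<in> monic_polys (n - k)"
    have "degree (C * R) = degree C + degree R" using C0 nz[OF R] by (simp add: degree_mult_eq)
    moreover have "lead_coeff (C * R) = lead_coeff C * lead_coeff R" by (rule lead_coeff_mult)
    ultimately show "C * R \<in> {P \<in> monic_polys n. C dvd P}"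
      using C R k by (auto simp: monic_polys_def F_poly_mult)
    show "C * R div C = R" using C0 by simp
  qed
  also have "\<dots> = (\<Sum>R\<in>monic_polys (n - k). \<psi> (tot C) * \<psi> (tot R))"
  proof (rule sum.cong[OF refl])
    fix R assume R: "R \<in> monic_polys (n - k)"
    then have "tot R \<in> Fq" using nz[OF R] by (intro tot_in_F) (auto simp: monic_polys_def)
    then show "\<psi> (tot (C * R)) = \<psi> (tot C) * \<psi> (tot R)"
      using nz[OF R] C0 CF by (simp add: tot_mult psi_add tot_in_F)
  qed
  finally show ?thesis by (simp add: L_coeff_def sum_distrib_left)
qed

text \<open>The factor \<open>n\<close> counts, for each \<open>P\<close>, the pairs
  \<open>(k, x)\<close> whose orbit polynomial divides \<open>P\<close>; after exchanging the sums,
  each pair carries the sum over all multiples of one orbit polynomial. For generating functions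
  this says \<open>T * L' = L * sum S_k T^k\<close>.\<close>

lemma newton_identity_L:
  "of_nat n * L_coeff n = (\<Sum>k=1..n. ext_sum k * L_coeff (n - k))"
proof -
  have "of_nat n * L_coeff n = (\<Sum>P\<in>monic_polys n. \<psi> (tot P) * of_nat n)"
    by (simp add: L_coeff_def sum_distrib_left mult.commute)
  also have "\<dots> = (\<Sum>P\<in>monic_polys n. \<Sum>k=1..n. \<Sum>x\<in>F k. if orbit_poly k x dvd P then \<psi> (tot P) else 0)"
  proof (rule sum.cong[OF refl])
    fix P assume P: "P \<in> monic_polys n"
    then have dP: "degree P = n" "lead_coeff P = 1" "F_poly P" by (auto simp: monic_polys_def)
    have "n = (\<Sum>k=1..n. card {x \<in> F k. orbit_poly k x dvd P})"
      using degree_eq_sum_orbit_dvd[OF dP(3,2)] unfolding dP(1) .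
    then have "(of_nat n :: complex) = of_nat (\<Sum>k=1..n. card {x \<in> F k. orbit_poly k x dvd P})"
      by (rule arg_cong)
    also have "\<dots> = (\<Sum>k=1..n. of_nat (card {x \<in> F k. orbit_poly k x dvd P}))"
      by (rule of_nat_sum)
    finally have "\<psi> (tot P) * of_nat n
        = \<psi> (tot P) * (\<Sum>k=1..n. of_nat (card {x \<in> F k. orbit_poly k x dvd P}))" by (rule arg_cong)
    also have "\<dots> = (\<Sum>k=1..n. \<Sum>x\<in>F k. if orbit_poly k x dvd P then \<psi> (tot P) else 0)"
      unfolding sum_distrib_left
    proof (rule sum.cong[OF refl])
      fix k assume "k \<in> {1..n}"
      then have "finite (F k)" by (intro finite_F) auto
      then show "\<psi> (tot P) * of_nat (card {x \<in> F k. orbit_poly k x dvd P})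
          = (\<Sum>x\<in>F k. if orbit_poly k x dvd P then \<psi> (tot P) else 0)"
        by (simp add: sum.If_cases Int_def mult.commute)
    qed
    finally show "\<psi> (tot P) * of_nat n
      = (\<Sum>k=1..n. \<Sum>x\<in>F k. if orbit_poly k x dvd P then \<psi> (tot P) else 0)" .
  qed
  also have "\<dots> = (\<Sum>k=1..n. \<Sum>P\<in>monic_polys n. \<Sum>x\<in>F k. if orbit_poly k x dvd P then \<psi> (tot P) else 0)"
    by (rule sum.swap)
  also have "\<dots> = (\<Sum>k=1..n. ext_sum k * L_coeff (n - k))"
  proof (rule sum.cong[OF refl])
    fix k assume k: "k \<in> {1..n}"
    have "(\<Sum>P\<in>monic_polys n. \<Sum>x\<in>F k. if orbit_poly k x dvd P then \<psi> (tot P) else 0)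
        = (\<Sum>x\<in>F k. \<Sum>P\<in>monic_polys n. if orbit_poly k x dvd P then \<psi> (tot P) else 0)"
      by (rule sum.swap)
    also have "\<dots> = (\<Sum>x\<in>F k. \<psi> (tr k (poly h x)) * L_coeff (n - k))"
    proof (rule sum.cong[OF refl])
      fix x assume x: "x \<in> F k"
      then have "orbit_poly k x \<in> monic_polys k"
        by (simp add: monic_polys_def degree_orbit_poly lead_coeff_orbit_poly F_poly_orbit_poly)
          (metis degree_orbit_poly lead_coeff_orbit_poly)
      from sum_multiples[OF this] k
      show "(\<Sum>P\<in>monic_polys n. if orbit_poly k x dvd P then \<psi> (tot P) else 0)
          = \<psi> (tr k (poly h x)) * L_coeff (n - k)"
        by (simp add: sum.inter_filter[symmetric] finite_monic_polys tot_orbit_poly)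
    qed
    also have "\<dots> = ext_sum k * L_coeff (n - k)" by (simp add: ext_sum_def sum_distrib_right)
    finally show "(\<Sum>P\<in>monic_polys n. \<Sum>x\<in>F k. if orbit_poly k x dvd P then \<psi> (tot P) else 0)
      = ext_sum k * L_coeff (n - k)" .
  qed
  finally show ?thesis .
qed

lemma F_inverse: "x \<in> F n \<Longrightarrow> inverse x \<in> F n"
  by (simp add: F_def power_inverse)

lemma tot_eq_power_sums: "tot P = (\<Sum>i\<le>degree h. coeff h i * (\<Sum>x\<in>#proots P. x ^ i))"
proof -
  have "(\<Sum>x\<in>#A. poly h x) = (\<Sum>i\<le>degree h. coeff h i * (\<Sum>x\<in>#A. x ^ i))" for A
    by (induction A) (auto simp: poly_altdef sum.distrib algebra_simps)
  then show ?thesis by (simp add: tot_def)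
qed

text \<open>
  Adding $c X^{n-d}$ to $P$ changes only the last of the power sums entering $\psi$, by Newton's
  identities by $- d c$; this is where $p \nmid d$ is needed.
\<close>

lemma L_coeff_eq_0:
  assumes n: "degree h \<le> n"
  shows "L_coeff n = 0"
proof -
  let ?d = "degree h"
  have d0: "?d > 0" using deg_h by (cases "?d") auto
  obtain c0 where c0: "c0 \<in> Fq" "\<psi> c0 \<noteq> 1" using psi_nontrivial by auto
  define u where "u = of_nat ?d * lead_coeff h"
  have u: "u \<noteq> 0" "u \<in> Fq"
    using deg_h d0 h_F by (auto simp: u_def of_nat_eq_0_iff_char_dvd F_poly_def intro: F_mult Fq_of_nat)
  \<comment> \<open>Chosen so that \<open>T\<close> raises \<open>tot\<close> by exactly
    \<open>c0\<close>: power sum \<open>d\<close> changes by \<open>- d * c\<close>, and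
    \<open>tot\<close> weights it with the leading coefficient of \<open>h\<close>.\<close>
  define c where "c = - (c0 * inverse u)"
  have c: "c \<in> Fq" using c0 u by (auto simp: c_def intro!: F_minus F_mult F_inverse)
  have uc: "- (u * c) = c0" using u by (simp add: c_def)
  define T where "T = (\<lambda>P. P + monom c (n - ?d))"
  have T_in: "P + monom b (n - ?d) \<in> monic_polys n" if "P \<in> monic_polys n" "b \<in> Fq" for P b
  proof -
    have lt: "degree (monom b (n - ?d)) < degree P"
      using that n d0 by (auto simp: monic_polys_def intro!: le_less_trans[OF degree_monom_le])
    have "n - ?d \<noteq> n" using n d0 by auto
    with lt show ?thesis using that
      by (auto simp: monic_polys_def degree_add_eq_left F_poly_add F_poly_monom)
  qed
  have tot_T: "tot (T P) = c0 + tot P" if P: "P \<in> monic_polys n" for P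
  proof -
    let ?A = "proots (T P)" and ?B = "proots P"
    let ?cA = "coeff (\<Prod>x\<in>#?A. [:1, -x:])" and ?cB = "coeff (\<Prod>x\<in>#?B. [:1, -x:])"
    have TP: "T P \<in> monic_polys n" unfolding T_def by (rule T_in[OF P c])
    have size: "size ?A = n" "size ?B = n" using P TP by (auto simp: size_proots_alg_closed monic_polys_def)
    have cA: "?cA i = coeff (T P) (n - i)" and cB: "?cB i = coeff P (n - i)" if "i \<le> n" for i
    proof -
      have "lead_coeff (T P) = 1" "lead_coeff P = 1" using P TP by (auto simp: monic_polys_def)
      then have "T P = (\<Prod>x\<in>#?A. [:-x, 1:])" "P = (\<Prod>x\<in>#?B. [:-x, 1:])"
        by (auto intro: monic_eq_prod_proots)
      then show "?cA i = coeff (T P) (n - i)" "?cB i = coeff P (n - i)"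
        using coeff_reflect_prod_linear[of i ?A] coeff_reflect_prod_linear[of i ?B] that size by metis+
    qed
    have eq: "?cA i = ?cB i" if "i < ?d" for i
    proof -
      have "i \<le> n" using that n by simp
      then have "?cA i = coeff (T P) (n - i)" by (rule cA)
      also have "\<dots> = coeff P (n - i)" using that n by (simp add: T_def)
      also have "\<dots> = ?cB i" using \<open>i \<le> n\<close> by (rule cB[symmetric])
      finally show ?thesis .
    qed
    have "tot (T P) - tot P = (\<Sum>i\<le>?d. coeff h i * ((\<Sum>x\<in>#?A. x ^ i) - (\<Sum>x\<in>#?B. x ^ i)))"
      by (simp add: tot_eq_power_sums sum_subtractf algebra_simps)
    also have "\<dots> = (\<Sum>i\<in>{?d}. coeff h i * ((\<Sum>x\<in>#?A. x ^ i) - (\<Sum>x\<in>#?B. x ^ i)))"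
    proof (rule sum.mono_neutral_right)
      show "\<forall>i\<in>{..?d} - {?d}. coeff h i * ((\<Sum>x\<in>#?A. x ^ i) - (\<Sum>x\<in>#?B. x ^ i)) = 0"
      proof
        fix i assume i: "i \<in> {..?d} - {?d}"
        have "(\<Sum>x\<in>#?A. x ^ i) = (\<Sum>x\<in>#?B. x ^ i)"
        proof (cases "i = 0")
          \<comment> \<open>Newton's identities do not cover exponent 0, where the power sum is the
            number of roots.\<close>
          case True then show ?thesis using size by simp
        next
          case False
          then show ?thesis using i by (intro power_sums_perturb(1)[of ?d, OF eq]) auto
        qed
        then show "coeff h i * ((\<Sum>x\<in>#?A. x ^ i) - (\<Sum>x\<in>#?B. x ^ i)) = 0" by simp
      qed
    qed auto
    also have "\<dots> = lead_coeff h * - (of_nat ?d * (?cA ?d - ?cB ?d))"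
      using power_sums_perturb(2)[of ?d ?A ?B, OF eq d0] by simp
    also have "?cA ?d - ?cB ?d = c"
      unfolding cA[OF n] cB[OF n] by (simp add: T_def)
    also have "lead_coeff h * - (of_nat ?d * c) = c0" using uc by (simp add: u_def mult_ac)
    finally show ?thesis by (simp add: algebra_simps)
  qed
  \<comment> \<open>\<open>T\<close> permutes the monic polynomials of degree \<open>n\<close> and
    multiplies every summand by \<open>\<psi> c0\<close>, which is not 1.\<close>
  have "L_coeff n = (\<Sum>P\<in>monic_polys n. \<psi> (tot (T P)))"
    unfolding L_coeff_def
  proof (rule sum.reindex_bij_witness[of _ T "\<lambda>P. P + monom (- c) (n - ?d)"])
    fix P assume P: "P \<in> monic_polys n"
    show "P + monom (- c) (n - ?d) \<in> monic_polys n" by (rule T_in[OF P F_minus[OF c]])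
    show "T P \<in> monic_polys n" unfolding T_def by (rule T_in[OF P c])
  qed (auto simp: T_def simp flip: add_monom minus_monom)
  also have "\<dots> = \<psi> c0 * L_coeff n"
    unfolding L_coeff_def sum_distrib_left
  proof (rule sum.cong[OF refl])
    fix P assume P: "P \<in> monic_polys n"
    then have "tot P \<in> Fq" by (intro tot_in_F) (auto simp: monic_polys_def)
    then show "\<psi> (tot (T P)) = \<psi> c0 * \<psi> (tot P)" using tot_T[OF P] c0 by (simp add: psi_add)
  qed
  finally show ?thesis using c0 by simp
qed

text \<open>The upper bound on every fibre of the trace suffices, because $\psi$ sums to zero over $F_q$.\<close>

lemma norm_ext_sum_le:
  assumes n: "q ^ (n div 2) \<ge> degree h + 3"
  shows "norm (ext_sum n) \<le> (2 * degree h + 2) * real q powr (3 / 2) * sqrt q ^ n"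
proof -
  define m where "m = n div 2"
  define M where "M = n - m"
  let ?d = "degree h"
  have m: "m \<ge> 1" using n by (cases m) (auto simp: m_def)
  have mM: "m + M = n" "m \<le> M" "2 * M \<le> n + 1" by (auto simp: m_def M_def)
  define B where "B = q ^ (n - 1) + (2 * ?d + 2) * q ^ M"
  have n0: "n > 0" using mM m by auto
  let ?N = "\<lambda>b. card {x \<in> F n. tr n (poly h x) = b}"
  have N: "?N b \<le> B" if "b \<in> Fq" for b
    using stepanov_bound[OF refl deg_h m mM(2) n[folded m_def] that] unfolding mM(1) B_def .
  have hF: "poly h x \<in> F n" if "x \<in> F n" for x
    using that poly_power_q[OF h_F, of x n] by (simp add: F_def)
  have trF: "tr n (poly h x) \<in> Fq" if "x \<in> F n" for x by (rule tr_in_Fq[OF hF[OF that] n0])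
  have fin: "finite (F n)" "finite (Fq)" using n0 finite_F by auto
  have "ext_sum n = (\<Sum>b\<in>Fq. \<Sum>x\<in>{x \<in> F n. tr n (poly h x) = b}. \<psi> (tr n (poly h x)))"
    unfolding ext_sum_def by (rule sum.group[symmetric]) (use fin trF in auto)
  also have "\<dots> = (\<Sum>b\<in>Fq. of_nat (?N b) * \<psi> b)" by simp
  also have "\<dots> = - (\<Sum>b\<in>Fq. of_nat (B - ?N b) * \<psi> b)"
  proof -
    have "(\<Sum>b\<in>Fq. of_nat (B - ?N b) * \<psi> b) = (\<Sum>b\<in>Fq. of_nat B * \<psi> b - of_nat (?N b) * \<psi> b)"
      using N by (intro sum.cong) (auto simp: of_nat_diff algebra_simps)
    also have "\<dots> = - (\<Sum>b\<in>Fq. of_nat (?N b) * \<psi> b)"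
      by (simp add: sum_subtractf sum_psi flip: sum_distrib_left)
    finally show ?thesis by simp
  qed
  finally have "norm (ext_sum n) \<le> (\<Sum>b\<in>Fq. norm (of_nat (B - ?N b) * \<psi> b))"
    by (simp add: norm_sum)
  also have "\<dots> = (\<Sum>b\<in>Fq. real (B - ?N b))"
    by (intro sum.cong) (auto simp: norm_mult psi_norm)
  also have "\<dots> = (\<Sum>b\<in>Fq. real B - real (?N b))"
    using N by (intro sum.cong) (auto simp: of_nat_diff)
  also have "\<dots> = real (q * B) - (\<Sum>b\<in>Fq. real (?N b))"
    by (simp add: sum_subtractf card_F del: One_nat_def)
  also have "(\<Sum>b\<in>Fq. real (?N b)) = real (card (F n))"
  proof -
    have "(\<Sum>b\<in>Fq. ?N b) = card (F n)"
      using sum.group[of "F n" "Fq" "\<lambda>x. tr n (poly h x)" "\<lambda>_. 1::nat"] fin trF by auto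
    then show ?thesis by (simp only: of_nat_sum[symmetric])
  qed
  also have "card (F n) = q ^ n" using n0 by (rule card_F)
  \<comment> \<open>The main terms cancel, as \<open>q * q ^ (n - 1) = q ^ n\<close>; what survives
    is \<open>q\<close> times the error of Stepanov's bound.\<close>
  also have "real (q * B) - real (q ^ n) = (2 * ?d + 2) * real q ^ (M + 1)"
    using n0 by (cases n) (auto simp: B_def algebra_simps)
  \<comment> \<open>The exponent \<open>3 / 2\<close> comes from \<open>2 * M <= n + 1\<close>; its
    factor is independent of \<open>n\<close>.\<close>
  also have "real q ^ (M + 1) \<le> real q powr (3 / 2) * sqrt q ^ n"
  proof -
    have "real q ^ (M + 1) = real q powr (real M + 1)" using powr_realpow[of "real q" "M + 1"]
      by (simp add: add.commute)
    also have "\<dots> \<le> real q powr (3 / 2 + real n / 2)"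
      using mM q_gt_1 by (intro powr_mono) auto
    also have "\<dots> = real q powr (3 / 2) * (real q powr (1 / 2)) ^ n"
      by (simp add: powr_add powr_power)
    finally show ?thesis by (simp add: powr_half_sqrt)
  qed
  finally show ?thesis by (simp add: mult.assoc mult_left_mono)
qed

end

section \<open>Weil's bound\<close>

text \<open>\<open>coeff L 1 / coeff L 0\<close> is minus the sum of the inverses of the roots, each
  of norm at most \<open>R\<close>.\<close>

lemma norm_coeff_1_le_roots:
  fixes L :: "complex poly" and R :: real
  assumes "coeff L 0 \<noteq> 0" "R \<ge> 0" "\<And>z. poly L z = 0 \<Longrightarrow> 1 \<le> R * norm z"
  shows "norm (coeff L 1) \<le> degree L * R * norm (coeff L 0)"
  using assms
proof (induction "degree L" arbitrary: L)
  case 0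
  then show ?case by (simp add: coeff_eq_0)
next
  case (Suc n)
  then obtain z where z: "poly L z = 0" using alg_closed_imp_poly_has_root[of L] by auto
  then obtain N where L: "L = [:-z, 1:] * N" by (metis poly_eq_0_iff_dvd dvdE)
  have "L \<noteq> 0" using Suc by auto
  then have N0: "N \<noteq> 0" using L by auto
  have deg: "degree L = Suc (degree N)" unfolding L using N0 by (subst degree_mult_eq) auto
  have c: "coeff L 0 = - z * coeff N 0" "coeff L 1 = coeff N 0 - z * coeff N 1"
    by (simp_all add: L)
  have IH: "norm (coeff N 1) \<le> degree N * R * norm (coeff N 0)"
  proof (rule Suc.hyps(1))
    show "n = degree N" using Suc.hyps deg by simp
    show "coeff N 0 \<noteq> 0" using Suc.prems(1) c by auto
    show "1 \<le> R * norm y" if "poly N y = 0" for y using Suc.prems(3)[of y] that by (simp add: L)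
  qed (use Suc in auto)
  have "norm (coeff L 1) \<le> norm (coeff N 0) + norm z * norm (coeff N 1)"
    unfolding c by (metis norm_mult norm_triangle_ineq4)
  also have "norm (coeff N 0) \<le> (R * norm z) * norm (coeff N 0)"
    using Suc.prems(3)[OF z] by (simp add: mult_right_mono[of 1 "R * norm z" "norm (coeff N 0)", simplified])
  also have "norm z * norm (coeff N 1) \<le> norm z * (degree N * R * norm (coeff N 0))"
    using IH by (intro mult_left_mono) auto
  also have "R * norm z * norm (coeff N 0) + norm z * (degree N * R * norm (coeff N 0))
      = degree L * R * norm (coeff L 0)"
    by (simp add: deg c norm_mult algebra_simps)
  finally show ?case by simp
qed

text \<open>The recursion says \<open>z * L' = F * L\<close> for the power series \<open>F\<close>
  with coefficients \<open>S n\<close>, which converges for \<open>R * norm z < 1\<close> whatever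
  \<open>C\<close> and \<open>n0\<close> are. A zero of \<open>L\<close> in this disc, necessarily
  nonzero, would be a pole of \<open>z * L' / L = F\<close>.\<close>

lemma roots_bound_from_log_derivative:
  fixes L :: "complex poly" and S :: "nat \<Rightarrow> complex"
  assumes L0: "coeff L 0 = 1" and R: "R > 0" and C: "\<And>n. n \<ge> n0 \<Longrightarrow> norm (S n) \<le> C * R ^ n"
    and rec: "\<And>n. of_nat n * coeff L n = (\<Sum>k=1..n. S k * coeff L (n - k))"
    and root: "poly L z0 = 0"
  shows "1 \<le> R * norm z0"
proof (rule ccontr)
  assume "\<not> 1 \<le> R * norm z0"
  then have small: "R * norm z0 < 1" by simp
  \<comment> \<open>The recursion starts at \<open>k = 1\<close> and leaves \<open>S 0\<close> open;
    the Cauchy product requires constant term 0.\<close>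
  define T where "T = (\<lambda>n. if n = 0 then 0 else S n)"
  define F where "F = (\<lambda>z. \<Sum>n. T n * z ^ n)"
  have summ: "summable (\<lambda>n. norm (T n * z ^ n))" if z: "R * norm z < 1" for z
  proof (rule summable_comparison_test_ev)
    show "summable (\<lambda>n. \<bar>C\<bar> * (R * norm z) ^ n)"
      using z R by (intro summable_mult summable_geometric) auto
    have "norm (norm (T n * z ^ n)) \<le> \<bar>C\<bar> * (R * norm z) ^ n" if n: "n \<ge> max 1 n0" for n
    proof -
      have "norm (T n) \<le> \<bar>C\<bar> * R ^ n"
        using C[of n] n R by (auto simp: T_def intro: order_trans[OF _ mult_right_mono[OF abs_ge_self]])
      then have "norm (T n) * norm z ^ n \<le> \<bar>C\<bar> * R ^ n * norm z ^ n" by (intro mult_right_mono) auto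
      then show ?thesis by (simp add: norm_mult norm_power power_mult_distrib mult.assoc)
    qed
    then show "\<forall>\<^sub>F n in sequentially. norm (norm (T n * z ^ n)) \<le> \<bar>C\<bar> * (R * norm z) ^ n"
      unfolding eventually_sequentially by blast
  qed
  have poly_sums: "(\<lambda>n. coeff P n * z ^ n) sums poly P z" for P and z :: complex
    unfolding poly_altdef by (rule sums_finite) (auto simp: coeff_eq_0)
  have ode: "z * poly (pderiv L) z = F z * poly L z" if z: "R * norm z < 1" for z
  proof -
    have fin: "summable (\<lambda>n. norm (coeff L n * z ^ n))"
      by (rule summable_finite[of "{..degree L}"]) (auto simp: coeff_eq_0)
    have "F z * poly L z = (\<Sum>n. T n * z ^ n) * (\<Sum>n. coeff L n * z ^ n)"
      using poly_sums[of L z] by (simp add: F_def sums_iff)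
    also have "\<dots> = (\<Sum>n. \<Sum>i\<le>n. (T i * z ^ i) * (coeff L (n - i) * z ^ (n - i)))"
      by (rule Cauchy_product[OF summ[OF z] fin])
    also have "\<dots> = (\<Sum>n. coeff (pCons 0 (pderiv L)) n * z ^ n)"
    proof (rule suminf_cong)
      fix n
      have "(\<Sum>i\<le>n. (T i * z ^ i) * (coeff L (n - i) * z ^ (n - i)))
          = (\<Sum>i\<le>n. T i * coeff L (n - i)) * z ^ n"
        unfolding sum_distrib_right
        by (intro sum.cong refl) (simp add: power_add[symmetric] mult_ac)
      also have "(\<Sum>i\<le>n. T i * coeff L (n - i)) = (\<Sum>k=1..n. S k * coeff L (n - k))"
        by (rule sum.mono_neutral_cong_right) (auto simp: T_def)
      also have "\<dots> = of_nat n * coeff L n" by (rule rec[symmetric])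
      also have "\<dots> = coeff (pCons 0 (pderiv L)) n"
        by (cases n) (auto simp: coeff_pderiv)
      finally show "(\<Sum>i\<le>n. (T i * z ^ i) * (coeff L (n - i) * z ^ (n - i)))
          = coeff (pCons 0 (pderiv L)) n * z ^ n" .
    qed
    also have "\<dots> = z * poly (pderiv L) z"
      using poly_sums[of "pCons 0 (pderiv L)" z] by (simp add: sums_iff)
    finally show ?thesis ..
  qed
  have Lnz: "L \<noteq> 0" using L0 by auto
  have z0: "z0 \<noteq> 0" using root L0 by (auto simp: poly_0_coeff_0)
  obtain N where N: "L = [:-z0, 1:] ^ order z0 L * N" "\<not> [:-z0, 1:] dvd N"
    using order_decomp[OF Lnz] by blast
  have "order z0 L \<noteq> 0" using root Lnz by (simp add: order_root)
  then obtain m where m: "order z0 L = Suc m" by (cases "order z0 L") auto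
  have L: "L = [:-z0, 1:] ^ Suc m * N" using N(1) unfolding m .
  have Nz: "poly N z0 \<noteq> 0" using N by (simp add: poly_eq_0_iff_dvd)
  \<comment> \<open>One factor fewer than the multiplicity is cancelled, so that
    \<open>z - z0\<close> stays on the right. The cancellation excludes \<open>z = z0\<close>, which
    is why a limit follows.\<close>
  have eq: "z * (of_nat (Suc m) * poly N z + (z - z0) * poly (pderiv N) z) = F z * ((z - z0) * poly N z)"
    if z: "R * norm z < 1" "z \<noteq> z0" for z
  proof -
    have poly_linear: "poly [:-z0, 1:] z = z - z0" by simp
    have "poly (pderiv L) z = (z - z0) ^ m * (of_nat (Suc m) * poly N z + (z - z0) * poly (pderiv N) z)"
      unfolding L pderiv_mult pderiv_power_Suc by (simp add: pderiv_pCons algebra_simps)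
    moreover have "poly L z = (z - z0) ^ m * ((z - z0) * poly N z)"
      by (simp only: L poly_mult poly_power poly_linear power_Suc2 mult.assoc)
    ultimately have "(z - z0) ^ m * (z * (of_nat (Suc m) * poly N z + (z - z0) * poly (pderiv N) z))
        = (z - z0) ^ m * (F z * ((z - z0) * poly N z))"
      using ode[OF z(1)] by (simp add: mult_ac)
    then show ?thesis using z(2) by simp
  qed
  have cont: "isCont F z0"
  proof -
    obtain \<rho> where \<rho>: "norm z0 < \<rho>" "\<rho> < 1 / R"
      using small R dense[of "norm z0" "1 / R"] by (auto simp: field_simps)
    then have "\<rho> \<ge> 0" using norm_ge_zero[of z0] by linarith
    then have "R * norm (complex_of_real \<rho>) < 1" using \<rho> R by (simp add: field_simps)
    then have "summable (\<lambda>n. T n * complex_of_real \<rho> ^ n)" by (rule summable_norm_cancel[OF summ])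
    then show ?thesis unfolding F_def using \<rho> \<open>\<rho> \<ge> 0\<close> by (intro isCont_powser) auto
  qed
  have lim1: "((\<lambda>z. z * (of_nat (Suc m) * poly N z + (z - z0) * poly (pderiv N) z)) \<longlongrightarrow>
      z0 * (of_nat (Suc m) * poly N z0 + (z0 - z0) * poly (pderiv N) z0)) (at z0)"
    by (intro tendsto_intros)
  have lim2: "((\<lambda>z. F z * ((z - z0) * poly N z)) \<longlongrightarrow> F z0 * ((z0 - z0) * poly N z0)) (at z0)"
    using cont by (intro tendsto_intros) (simp add: isCont_def)
  have ev: "eventually (\<lambda>z. z * (of_nat (Suc m) * poly N z + (z - z0) * poly (pderiv N) z)
      = F z * ((z - z0) * poly N z)) (at z0)"
  proof -
    have "open {z. R * norm z < 1}" by (intro open_Collect_less continuous_intros)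
    then have "eventually (\<lambda>z. z \<in> {z. R * norm z < 1}) (at z0)"
      using small by (intro eventually_at_in_open') auto
    moreover have "eventually (\<lambda>z. z \<noteq> z0) (at z0)" by (rule eventually_neq_at_within)
    ultimately show ?thesis by eventually_elim (use eq in auto)
  qed
  have "z0 * (of_nat (Suc m) * poly N z0 + (z0 - z0) * poly (pderiv N) z0)
      = F z0 * ((z0 - z0) * poly N z0)"
    by (rule tendsto_unique[OF at_neq_bot Lim_transform_eventually[OF lim1 ev] lim2])
  then have "z0 * (of_nat (Suc m) * poly N z0) = 0" by simp
  then show False using z0 Nz by (simp add: of_nat_neq_0 del: of_nat_Suc)
qed

context additive_character_sum begin

theorem weil_bound:
  "norm (\<Sum>x\<in>Fq. \<psi> (poly h x)) \<le> (real (degree h) - 1) * sqrt q"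
proof -
  let ?d = "degree h"
  have d0: "?d > 0" using deg_h by (cases "?d") auto
  define L where "L = (\<Sum>n<?d. monom (L_coeff n) n)"
  have coeff_L: "coeff L n = L_coeff n" for n
    using L_coeff_eq_0[of n] by (auto simp: L_def coeff_sum coeff_monom not_less)
  have deg_L: "degree L \<le> ?d - 1"
    by (rule degree_le) (use d0 in \<open>auto simp: coeff_L intro!: L_coeff_eq_0\<close>)
  have q0: "sqrt q > 0" using q_pos by simp
  have "1 \<le> sqrt q * norm z" if "poly L z = 0" for z
  proof (rule roots_bound_from_log_derivative[OF _ q0 _ _ that])
    show "coeff L 0 = 1" by (simp add: coeff_L L_coeff_0)
    show "of_nat n * coeff L n = (\<Sum>k=1..n. ext_sum k * coeff L (n - k))" for n
      unfolding coeff_L by (rule newton_identity_L)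
    \<comment> \<open>Any threshold that ensures Stepanov's size condition would do; this one makes
      \<open>n div 2\<close> itself at least \<open>?d + 3\<close>.\<close>
    fix n assume n: "n \<ge> 2 * (?d + 3)"
    have "?d + 3 \<le> n div 2" using n by presburger
    also have "n div 2 < 2 ^ (n div 2)" by (rule less_exp)
    also have "\<dots> \<le> q ^ (n div 2)" using q_gt_1 by (intro power_mono) auto
    finally show "norm (ext_sum n) \<le> (2 * ?d + 2) * real q powr (3 / 2) * sqrt q ^ n"
      by (intro norm_ext_sum_le) simp
  qed
  then have "norm (coeff L 1) \<le> degree L * sqrt q * norm (coeff L 0)"
    by (intro norm_coeff_1_le_roots[of L "sqrt q"]) (auto simp: coeff_L L_coeff_0)
  also have "\<dots> \<le> (real ?d - 1) * sqrt q"
    using deg_L d0 by (auto simp: coeff_L L_coeff_0 intro!: mult_right_mono)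
  also have "coeff L 1 = ext_sum 1" using newton_identity_L[of 1] by (simp add: coeff_L L_coeff_0)
  also have "ext_sum 1 = (\<Sum>x\<in>Fq. \<psi> (poly h x))" by (simp add: ext_sum_def tr_def)
  finally show ?thesis .
qed

end

section \<open>Characters of finite fields and the eigenvalues of the graph\<close>

locale finite_field_character =
  fixes \<psi> :: "'a::{field,finite} \<Rightarrow> complex"
  assumes psi_add: "\<psi> (x + y) = \<psi> x * \<psi> y"
    and psi_norm: "norm (\<psi> x) = 1"
    and psi_nontrivial: "\<exists>x. \<psi> x \<noteq> 1"

lemma power_CHAR_of_nat:
  assumes "prime CHAR('a::idom)"
  shows "(of_nat k :: 'a) ^ CHAR('a) = of_nat k"
proof (induction k)
  case (Suc k)
  then show ?case using freshmans_dream[OF assms refl, of 1 "of_nat k"] by simp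
qed (use assms in \<open>auto simp: prime_gt_0_nat zero_power\<close>)

text \<open>The elements \<open>of_nat k\<close> with \<open>k < p\<close> are \<open>p\<close>
  distinct roots of \<open>X ^ p - X\<close>, which leaves no room for others.\<close>

lemma prime_subfield:
  assumes p: "prime CHAR('a::idom)" and x: "(x::'a) ^ CHAR('a) = x"
  shows "\<exists>k. x = of_nat k"
proof -
  let ?p = "CHAR('a)"
  define P :: "'a poly" where "P = monom 1 ?p - monom 1 1"
  have p1: "?p > 1" using p by (rule prime_gt_1_nat)
  have "coeff P ?p = 1" using p1 by (simp add: P_def)
  then have P0: "P \<noteq> 0" by auto
  have degP: "degree P \<le> ?p"
    unfolding P_def using p1 by (intro degree_diff_le degree_monom_le order_trans[OF degree_monom_le]) auto
  have "inj_on (of_nat :: nat \<Rightarrow> 'a) {..<?p}"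
  proof (rule linorder_inj_onI)
    fix i j assume ij: "i < j" "j \<in> {..<?p}"
    show "(of_nat i :: 'a) \<noteq> of_nat j"
    proof
      assume "(of_nat i :: 'a) = of_nat j"
      then have "of_nat (j - i) = (0::'a)" using ij by (simp add: of_nat_diff)
      then have "?p dvd j - i" by (simp add: of_nat_eq_0_iff_char_dvd)
      then have "?p \<le> j - i" using ij by (intro dvd_imp_le) auto
      then show False using ij by auto
    qed
  qed auto
  then have "card (of_nat ` {..<?p} :: 'a set) = ?p" by (simp add: card_image)
  moreover have sub: "of_nat ` {..<?p} \<subseteq> {x. poly P x = 0}"
    using power_CHAR_of_nat[OF p] by (auto simp: P_def poly_monom)
  moreover have "card {x. poly P x = 0} \<le> ?p"
    using card_poly_roots_bound[OF P0] degP by simp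
  ultimately have "of_nat ` {..<?p} = {x. poly P x = 0}"
    using poly_roots_finite[OF P0] by (intro card_seteq) auto
  moreover have "poly P x = 0" using x by (simp add: P_def poly_monom)
  ultimately show ?thesis by blast
qed

text \<open>The character is \<open>exp (2 * pi * i * Tr x / p)\<close> with the absolute trace
  \<open>Tr\<close>. It is nontrivial because \<open>Tr\<close> is given by a nonzero polynomial of
  degree at most \<open>p ^ (e - 1)\<close>, too small to vanish on the whole field.\<close>

lemma exists_finite_field_character:
  "\<exists>\<psi> :: 'a::{field,finite} \<Rightarrow> complex. finite_field_character \<psi>"
proof -
  let ?p = "CHAR('a)"
  have p: "prime ?p" by (rule prime_CHAR_finite)
  obtain e where e: "e > 0" "CARD('a) = ?p ^ e" using CARD_eq_CHAR_power by blast
  define Tr :: "'a \<Rightarrow> 'a" where "Tr = (\<lambda>x. \<Sum>i<e. x ^ (?p ^ i))"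
  have Tr_add: "Tr (x + y) = Tr x + Tr y" for x y
    unfolding Tr_def by (simp add: freshmans_dream'[OF p refl] sum.distrib)
  have Tr_p: "Tr x ^ ?p = Tr x" for x
  proof -
    obtain l where l: "e = Suc l" using e by (cases e) auto
    have "Tr x ^ ?p = (\<Sum>i<e. x ^ (?p ^ Suc i))"
      unfolding Tr_def freshmans_dream_sum[OF p refl] by (simp add: mult.commute flip: power_mult)
    also have "\<dots> = (\<Sum>i<l. x ^ (?p ^ Suc i)) + x ^ (?p ^ 0)"
      using power_card_eq_same[of x] by (simp add: e l)
    also have "\<dots> = Tr x" unfolding Tr_def l by (subst sum.lessThan_Suc_shift) simp
    finally show ?thesis .
  qed
  have "\<exists>k. Tr x = of_nat k" for x using prime_subfield[OF p Tr_p] .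
  \<comment> \<open>\<open>K x\<close> is an arbitrary natural number representing
    \<open>Tr x\<close>; \<open>zeta_eq\<close> makes the choice immaterial.\<close>
  then obtain K where K: "\<And>x. Tr x = of_nat (K x)" by metis
  define \<zeta> where "\<zeta> = (\<lambda>k::nat. cis (2 * pi * real k / real ?p))"
  have p0: "?p > 0" using p by (rule prime_gt_0_nat)
  have zeta_add: "\<zeta> (i + j) = \<zeta> i * \<zeta> j" for i j
    by (simp add: \<zeta>_def cis_mult add_divide_distrib distrib_left)
  have zeta_dvd: "\<zeta> (?p * t) = 1" for t
  proof -
    have "2 * pi * real (?p * t) / real ?p = 2 * pi * real t" using p0 by simp
    then show ?thesis unfolding \<zeta>_def by (simp only: cis_multiple_2pi Ints_of_nat)
  qed
  have zeta_eq: "\<zeta> i = \<zeta> j" if "of_nat i = (of_nat j :: 'a)" for i j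
  proof -
    have "\<zeta> i = \<zeta> j" if ij: "of_nat i = (of_nat j :: 'a)" "i \<le> j" for i j
    proof -
      have "of_nat (j - i) = (0::'a)" using ij by (simp add: of_nat_diff)
      then obtain t where "j - i = ?p * t" by (auto simp: of_nat_eq_0_iff_char_dvd)
      then have "j = i + ?p * t" using ij by simp
      then show ?thesis by (simp only: zeta_add zeta_dvd mult_1_right)
    qed
    then show ?thesis using that by (metis nat_le_linear)
  qed
  have "finite_field_character (\<lambda>x. \<zeta> (K x))"
  proof
    show "\<zeta> (K (x + y)) = \<zeta> (K x) * \<zeta> (K y)" for x y
      unfolding zeta_add[symmetric] by (rule zeta_eq) (simp add: Tr_add flip: K)
    show "norm (\<zeta> (K x)) = 1" for x by (simp add: \<zeta>_def)
    show "\<exists>x. \<zeta> (K x) \<noteq> 1"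
    proof (rule ccontr)
      assume "\<nexists>x. \<zeta> (K x) \<noteq> 1"
      then have one: "\<zeta> (K x) = 1" for x by simp
      have "Tr x = 0" for x
      proof -
        have "cos (2 * pi * real (K x) / real ?p) = 1"
          using one[of x] by (simp add: \<zeta>_def complex_eq_iff)
        then obtain n :: int where "2 * pi * real (K x) / real ?p = real_of_int n * 2 * pi"
          unfolding cos_one_2pi_int by blast
        then have "real (K x) = real_of_int n * real ?p" using p0 by (simp add: field_simps)
        then have "int (K x) = n * int ?p" by (metis of_int_eq_iff of_int_mult of_int_of_nat_eq)
        then have "?p dvd K x" by (metis dvd_triv_right of_nat_dvd_iff)
        then show ?thesis by (simp add: K of_nat_eq_0_iff_char_dvd)
      qed
      define P :: "'a poly" where "P = (\<Sum>i<e. monom 1 (?p ^ i))"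
      have p1: "?p > 1" using p by (rule prime_gt_1_nat)
      obtain l where l: "e = Suc l" using e by (cases e) auto
      have "coeff P (?p ^ l) = (\<Sum>i<e. if i = l then 1 else 0)"
        unfolding P_def coeff_sum using p1 by (intro sum.cong) (auto simp: power_inject_exp)
      then have P0: "P \<noteq> 0" using l by auto
      have "degree P \<le> ?p ^ l"
        unfolding P_def using p1 l
        by (intro degree_sum_le order_trans[OF degree_monom_le] power_increasing) auto
      also have "\<dots> < CARD('a)" using p1 by (simp add: e l)
      finally have "degree P < CARD('a)" .
      moreover have "poly P x = 0" for x
        using \<open>Tr x = 0\<close> by (simp add: P_def poly_sum poly_monom Tr_def)
      then have "CARD('a) \<le> degree P" using card_poly_roots_bound[OF P0] by simp
      ultimately show False by simp
    qed
  qed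
  then show ?thesis by blast
qed

lemma poly_map_poly_to_ac: "poly (map_poly to_ac P) (to_ac x) = to_ac (poly P x)"
  by (induction P) (auto simp: map_poly_pCons)

context finite_field_character begin

lemma psi_0: "\<psi> 0 = 1"
proof -
  have "\<psi> 0 * \<psi> 0 = \<psi> 0 * 1" using psi_add[of 0 0] by simp
  moreover have "\<psi> 0 \<noteq> 0" using psi_norm[of 0] by auto
  ultimately show ?thesis by (simp only: mult_cancel_left) simp
qed

text \<open>The bound is transported from the algebraic closure, where a count of elements shows
  that \<open>to_ac\<close> maps onto \<open>Fq\<close>. \<open>of_ac\<close> inverts
  \<open>to_ac\<close> there, and only on \<open>Fq\<close> does the locale demand a
  character.\<close>

lemma weil_bound_finite_field:
  fixes h :: "'a poly"
  assumes "\<not> CHAR('a) dvd degree h"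
  shows "norm (\<Sum>x\<in>UNIV. \<psi> (poly h x)) \<le> (real (degree h) - 1) * sqrt CARD('a)"
proof -
  obtain e where e: "e > 0" "CARD('a) = CHAR('a) ^ e" using CARD_eq_CHAR_power by blast
  let ?q = "CARD('a)" and ?h = "map_poly to_ac h"
  interpret finite_subfields ?q e "TYPE('a alg_closure)"
    by standard (use e prime_CHAR_finite in auto)
  have sub: "range to_ac \<subseteq> Fq"
    using power_card_eq_same by (auto simp: F_def simp flip: to_ac_power)
  have range: "Fq = range (to_ac :: 'a \<Rightarrow> _)"
    using sub card_F[of "Suc 0"] finite_F[of "Suc 0"]
    by (intro card_subset_eq[symmetric]) (auto simp: card_image inj_to_ac)
  have deg: "degree ?h = degree h" by (rule degree_map_poly) auto
  interpret additive_character_sum ?q e "TYPE('a alg_closure)" "\<lambda>y. \<psi> (of_ac y)" ?h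
  proof
    show "\<psi> (of_ac (x + y)) = \<psi> (of_ac x) * \<psi> (of_ac y)" if "x \<in> Fq" "y \<in> Fq" for x y
      using that by (auto simp: range psi_add simp flip: to_ac_add)
    show "\<exists>x\<in>Fq. \<psi> (of_ac x) \<noteq> 1" using psi_nontrivial by (auto simp: range)
    show "F_poly ?h" by (auto simp: F_poly_def coeff_map_poly range)
  qed (use assms in \<open>auto simp: psi_norm deg\<close>)
  have "(\<Sum>x\<in>Fq. \<psi> (of_ac (poly ?h x))) = (\<Sum>x\<in>UNIV. \<psi> (poly h x))"
    unfolding range by (subst sum.reindex) (auto simp: inj_to_ac poly_map_poly_to_ac)
  then show ?thesis using weil_bound by (simp add: deg)
qed

end

section \<open>The graph as a Cayley graph\<close>

lemma finite_S_vertices: "finite (S_vertices k :: (nat \<Rightarrow> 'a::{zero,finite}) set)"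
proof -
  have "S_vertices k = {a::nat\<Rightarrow>'a. \<forall>i. (i \<in> {1..k} \<longrightarrow> a i \<in> UNIV) \<and> (i \<notin> {1..k} \<longrightarrow> a i = 0)}"
  proof -
    have "i = 0 \<or> k < i \<longleftrightarrow> i \<notin> {1..k}" for i :: nat by auto
    then show ?thesis unfolding S_vertices_def by simp
  qed
  then show ?thesis using finite_set_of_finite_funs[of "{1..k}" "UNIV::'a set" 0] by simp
qed

text \<open>The connection set of the Cayley graph. For nonzero \<open>s\<close> the first two
  coordinates determine \<open>s\<close> and the slope \<open>u\<close> at which the
  \<open>f i\<close> are evaluated.\<close>

definition S_step :: "nat \<Rightarrow> (nat \<Rightarrow> 'a::field poly) \<Rightarrow> (nat \<Rightarrow> 'a poly) \<Rightarrow> 'a \<Rightarrow> 'a \<Rightarrow> nat \<Rightarrow> 'a" where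
  "S_step k f g s u i = (if i = 1 then s else if i = 2 then s * u
     else if i \<in> {3..k} then poly (g i) s * poly (f i) u else 0)"

lemma S_adj_iff_step:
  assumes "a \<in> S_vertices k" "b \<in> S_vertices k" "3 \<le> k" "s = b 1 - a 1" "u = (b 2 - a 2) / s"
  shows "S_adj k f g a b \<longleftrightarrow> s \<noteq> 0 \<and> (\<forall>i. b i - a i = S_step k f g s u i)"
proof
  assume A: "S_adj k f g a b"
  then have s: "s \<noteq> 0" using assms by (auto simp: S_adj_def)
  have "b i - a i = S_step k f g s u i" for i
  proof -
    consider "i = 1" | "i = 2" | "i \<in> {3..k}" | "i = 0 \<or> k < i" by fastforce
    then show ?thesis
      by cases (use A s assms in \<open>auto simp: S_step_def S_adj_def S_vertices_def\<close>)
  qed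
  with s show "s \<noteq> 0 \<and> (\<forall>i. b i - a i = S_step k f g s u i)" by blast
next
  assume A: "s \<noteq> 0 \<and> (\<forall>i. b i - a i = S_step k f g s u i)"
  have step: "b i - a i = poly (g i) s * poly (f i) u" if "i \<in> {3..k}" for i
  proof -
    have "b i - a i = S_step k f g s u i" using A by blast
    then show ?thesis using that by (simp add: S_step_def)
  qed
  have "a 1 \<noteq> b 1"
  proof
    assume "a 1 = b 1"
    then have "s = 0" by (simp add: assms(4))
    with A show False by blast
  qed
  with step show "S_adj k f g a b" unfolding S_adj_def assms(4,5)[symmetric] by blast
qed

lemma S_step_in_vertices: "3 \<le> k \<Longrightarrow> S_step k f g s u \<in> S_vertices k"
  by (auto simp: S_step_def S_vertices_def)

lemma S_step_simps [simp]: "S_step k f g s u (Suc 0) = s" "S_step k f g s u 2 = s * u"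
  by (auto simp: S_step_def)

lemma sum_S_adj_out:
  fixes x :: "(nat \<Rightarrow> 'a::{field,finite}) \<Rightarrow> 'b::comm_semiring_1"
  assumes k: "3 \<le> k" and a: "a \<in> S_vertices k"
  shows "(\<Sum>b\<in>S_vertices k. (if S_adj k f g a b then 1 else 0) * x b)
    = (\<Sum>(s,u)\<in>(UNIV - {0}) \<times> UNIV. x (\<lambda>i. a i + S_step k f g s u i))"
proof -
  have "(\<Sum>b\<in>S_vertices k. (if S_adj k f g a b then 1 else 0) * x b)
      = (\<Sum>b\<in>{b \<in> S_vertices k. S_adj k f g a b}. x b)"
    by (simp add: sum.inter_filter finite_S_vertices if_distrib[of "\<lambda>c. c * _"] cong: if_cong)
  also have "\<dots> = (\<Sum>(s,u)\<in>(UNIV - {0}) \<times> UNIV. x (\<lambda>i. a i + S_step k f g s u i))"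
  proof (rule sum.reindex_bij_witness[of _ "\<lambda>(s,u) i. a i + S_step k f g s u i"
        "\<lambda>b. (b 1 - a 1, (b 2 - a 2) / (b 1 - a 1))"])
    fix b assume b: "b \<in> {b \<in> S_vertices k. S_adj k f g a b}"
    then have B: "b 1 - a 1 \<noteq> 0"
        "b i - a i = S_step k f g (b 1 - a 1) ((b 2 - a 2) / (b 1 - a 1)) i" for i
      using S_adj_iff_step[OF a _ k refl refl, of b f g] by blast+
    have "(\<lambda>i. a i + S_step k f g (b 1 - a 1) ((b 2 - a 2) / (b 1 - a 1)) i) = b"
      by (rule ext) (simp only: B(2)[symmetric], simp)
    then show "(case (b 1 - a 1, (b 2 - a 2) / (b 1 - a 1)) of (s, u) \<Rightarrow> \<lambda>i. a i + S_step k f g s u i) = b"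
      "(case (b 1 - a 1, (b 2 - a 2) / (b 1 - a 1)) of (s, u) \<Rightarrow> x (\<lambda>i. a i + S_step k f g s u i)) = x b"
      by simp_all
    show "(b 1 - a 1, (b 2 - a 2) / (b 1 - a 1)) \<in> (UNIV - {0}) \<times> UNIV" using B(1) by simp
  next
    fix z :: "'a \<times> 'a" assume z: "z \<in> (UNIV - {0}) \<times> UNIV"
    obtain s u where su: "z = (s, u)" "s \<noteq> 0" using z by (cases z) auto
    define b where "b = (\<lambda>i. a i + S_step k f g s u i)"
    have bz: "(case z of (s, u) \<Rightarrow> \<lambda>i. a i + S_step k f g s u i) = b" by (simp add: su b_def)
    have 1: "b 1 - a 1 = s" "(b 2 - a 2) / s = u" using su by (auto simp: b_def)
    then show "((case z of (s, u) \<Rightarrow> \<lambda>i. a i + S_step k f g s u i) 1 - a 1,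
      ((case z of (s, u) \<Rightarrow> \<lambda>i. a i + S_step k f g s u i) 2 - a 2) /
      ((case z of (s, u) \<Rightarrow> \<lambda>i. a i + S_step k f g s u i) 1 - a 1)) = z"
      unfolding bz by (simp add: su)
    have V: "b \<in> S_vertices k"
      using a S_step_in_vertices[OF k, of f g s u] by (simp add: b_def S_vertices_def)
    have "S_adj k f g a b"
      using S_adj_iff_step[OF a V k 1(1)[symmetric] 1(2)[symmetric]] su by (simp add: b_def)
    with V show "(case z of (s, u) \<Rightarrow> \<lambda>i. a i + S_step k f g s u i) \<in> {b \<in> S_vertices k. S_adj k f g a b}"
      unfolding bz by simp
  qed
  finally show ?thesis .
qed

text \<open>Pairing the eigenvector equation with a character and exchanging sums leaves a sum over
  the first argument of \<open>S_adj\<close>; hence this counterpart of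
  \<open>sum_S_adj_out\<close>.\<close>

lemma sum_S_adj_in:
  fixes x :: "(nat \<Rightarrow> 'a::{field,finite}) \<Rightarrow> 'b::comm_semiring_1"
  assumes k: "3 \<le> k" and b: "b \<in> S_vertices k"
  shows "(\<Sum>a\<in>S_vertices k. (if S_adj k f g a b then 1 else 0) * x a)
    = (\<Sum>(s,u)\<in>(UNIV - {0}) \<times> UNIV. x (\<lambda>i. b i - S_step k f g s u i))"
proof -
  have "(\<Sum>a\<in>S_vertices k. (if S_adj k f g a b then 1 else 0) * x a)
      = (\<Sum>a\<in>{a \<in> S_vertices k. S_adj k f g a b}. x a)"
    by (simp add: sum.inter_filter finite_S_vertices if_distrib[of "\<lambda>c. c * _"] cong: if_cong)
  also have "\<dots> = (\<Sum>(s,u)\<in>(UNIV - {0}) \<times> UNIV. x (\<lambda>i. b i - S_step k f g s u i))"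
  proof (rule sum.reindex_bij_witness[of _ "\<lambda>(s,u) i. b i - S_step k f g s u i"
        "\<lambda>a. (b 1 - a 1, (b 2 - a 2) / (b 1 - a 1))"])
    fix a assume a: "a \<in> {a \<in> S_vertices k. S_adj k f g a b}"
    then have B: "b 1 - a 1 \<noteq> 0"
        "b i - a i = S_step k f g (b 1 - a 1) ((b 2 - a 2) / (b 1 - a 1)) i" for i
      using S_adj_iff_step[OF _ b k refl refl, of a f g] by blast+
    have "(\<lambda>i. b i - S_step k f g (b 1 - a 1) ((b 2 - a 2) / (b 1 - a 1)) i) = a"
      by (rule ext) (simp only: B(2)[symmetric], simp)
    then show "(case (b 1 - a 1, (b 2 - a 2) / (b 1 - a 1)) of (s, u) \<Rightarrow> \<lambda>i. b i - S_step k f g s u i) = a"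
      "(case (b 1 - a 1, (b 2 - a 2) / (b 1 - a 1)) of (s, u) \<Rightarrow> x (\<lambda>i. b i - S_step k f g s u i)) = x a"
      by simp_all
    show "(b 1 - a 1, (b 2 - a 2) / (b 1 - a 1)) \<in> (UNIV - {0}) \<times> UNIV" using B(1) by simp
  next
    fix z :: "'a \<times> 'a" assume z: "z \<in> (UNIV - {0}) \<times> UNIV"
    obtain s u where su: "z = (s, u)" "s \<noteq> 0" using z by (cases z) auto
    define a where "a = (\<lambda>i. b i - S_step k f g s u i)"
    have az: "(case z of (s, u) \<Rightarrow> \<lambda>i. b i - S_step k f g s u i) = a" by (simp add: su a_def)
    have 1: "b 1 - a 1 = s" "(b 2 - a 2) / s = u" using su by (auto simp: a_def)
    then show "(b 1 - (case z of (s, u) \<Rightarrow> \<lambda>i. b i - S_step k f g s u i) 1,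
      (b 2 - (case z of (s, u) \<Rightarrow> \<lambda>i. b i - S_step k f g s u i) 2) /
      (b 1 - (case z of (s, u) \<Rightarrow> \<lambda>i. b i - S_step k f g s u i) 1)) = z"
      unfolding az by (simp add: su)
    have V: "a \<in> S_vertices k"
      using b S_step_in_vertices[OF k, of f g s u] by (simp add: a_def S_vertices_def)
    have "S_adj k f g a b"
      using S_adj_iff_step[OF V b k 1(1)[symmetric] 1(2)[symmetric]] su by (simp add: a_def)
    with V show "(case z of (s, u) \<Rightarrow> \<lambda>i. b i - S_step k f g s u i) \<in> {a \<in> S_vertices k. S_adj k f g a b}"
      unfolding az by simp
  qed
  finally show ?thesis .
qed

text \<open>The polynomial \<open>H_u\<close>: its value at \<open>s\<close> is the pairing of the
  frequency \<open>w\<close> with the step given by \<open>s\<close> and \<open>u\<close>.\<close>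

definition freq_poly :: "nat \<Rightarrow> (nat \<Rightarrow> 'a::field poly) \<Rightarrow> (nat \<Rightarrow> 'a poly) \<Rightarrow> (nat \<Rightarrow> 'a) \<Rightarrow> 'a \<Rightarrow> 'a poly" where
  "freq_poly k f g w u = monom (w 1 + w 2 * u) 1 + (\<Sum>i=3..k. smult (w i * poly (f i) u) (g i))"

lemma sum_S_step:
  assumes "3 \<le> k"
  shows "(\<Sum>i=1..k. w i * S_step k f g s u i) = poly (freq_poly k f g w u) s"
proof -
  have "{1..k} = insert 1 (insert 2 {3..k})" using assms by auto
  then have "(\<Sum>i=1..k. w i * S_step k f g s u i)
      = w 1 * s + (w 2 * (s * u) + (\<Sum>i=3..k. w i * S_step k f g s u i))"
    by simp
  also have "(\<Sum>i=3..k. w i * S_step k f g s u i) = (\<Sum>i=3..k. w i * (poly (g i) s * poly (f i) u))"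
    by (intro sum.cong) (auto simp: S_step_def)
  finally show ?thesis by (simp add: freq_poly_def poly_monom poly_sum algebra_simps)
qed

section \<open>Fourier analysis of the adjacency matrix\<close>

context finite_field_character begin

definition char_of :: "nat \<Rightarrow> (nat \<Rightarrow> 'a) \<Rightarrow> (nat \<Rightarrow> 'a) \<Rightarrow> complex" where
  "char_of k w v = \<psi> (\<Sum>i=1..k. w i * v i)"

definition fourier_eigenvalue :: "nat \<Rightarrow> (nat \<Rightarrow> 'a poly) \<Rightarrow> (nat \<Rightarrow> 'a poly) \<Rightarrow> (nat \<Rightarrow> 'a) \<Rightarrow> complex" where
  "fourier_eigenvalue k f g w = (\<Sum>u\<in>UNIV. \<Sum>s\<in>UNIV - {0}. \<psi> (- poly (freq_poly k f g w u) s))"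

lemma char_of_add: "char_of k w (\<lambda>i. v i + v' i) = char_of k w v * char_of k w v'"
  by (simp add: char_of_def distrib_left sum.distrib psi_add)

lemma char_of_diff_step:
  assumes "3 \<le> k"
  shows "char_of k w (\<lambda>i. b i - S_step k f g s u i) = char_of k w b * \<psi> (- poly (freq_poly k f g w u) s)"
  unfolding char_of_def sum_S_step[OF assms, symmetric] psi_add[symmetric]
  by (simp add: right_diff_distrib sum_subtractf)

text \<open>Shifting \<open>w j\<close> by \<open>c / v j\<close> permutes the frequencies and
  multiplies the sum by \<open>\<psi> c\<close>, which is not 1 for a suitable
  \<open>c\<close>.\<close>

lemma sum_char_of_eq_0:
  assumes v: "v j \<noteq> 0" "j \<in> {1..k}"
  shows "(\<Sum>w\<in>S_vertices k. char_of k w v) = 0"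
proof -
  obtain c where c: "\<psi> c \<noteq> 1" using psi_nontrivial by auto
  define t where "t = c / v j"
  have shift: "char_of k (w(j := w j + t)) v = \<psi> c * char_of k w v" for w
  proof -
    have "(\<Sum>i=1..k. (w(j := w j + t)) i * v i) = (\<Sum>i=1..k. (if i = j then c else 0) + w i * v i)"
      using v by (intro sum.cong) (auto simp: t_def distrib_right)
    also have "\<dots> = c + (\<Sum>i=1..k. w i * v i)" using v by (simp add: sum.distrib)
    finally show ?thesis by (simp add: char_of_def psi_add)
  qed
  have "(\<Sum>w\<in>S_vertices k. char_of k w v) = (\<Sum>w\<in>S_vertices k. char_of k (w(j := w j + t)) v)"
    by (rule sum.reindex_bij_witness[of _ "\<lambda>w. w(j := w j + t)" "\<lambda>w. w(j := w j - t)"])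
       (use v in \<open>auto simp: S_vertices_def\<close>)
  also have "\<dots> = \<psi> c * (\<Sum>w\<in>S_vertices k. char_of k w v)" by (simp add: shift sum_distrib_left)
  finally show ?thesis using c by simp
qed

text \<open>By orthogonality, transforming back returns \<open>x v\<close> times the number of
  vertices.\<close>

lemma fourier_injective:
  fixes x :: "(nat \<Rightarrow> 'a) \<Rightarrow> complex"
  assumes zero: "\<And>w. w \<in> S_vertices k \<Longrightarrow> (\<Sum>a\<in>S_vertices k. x a * char_of k w a) = 0"
    and v: "v \<in> S_vertices k"
  shows "x v = 0"
proof -
  let ?V = "S_vertices k :: (nat \<Rightarrow> 'a) set"
  have "0 = (\<Sum>w\<in>?V. (\<Sum>a\<in>?V. x a * char_of k w a) * char_of k w (\<lambda>i. - v i))"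
    using zero by simp
  also have "\<dots> = (\<Sum>w\<in>?V. \<Sum>a\<in>?V. x a * char_of k w (\<lambda>i. a i - v i))"
    unfolding sum_distrib_right by (simp add: mult.assoc flip: char_of_add)
  also have "\<dots> = (\<Sum>a\<in>?V. \<Sum>w\<in>?V. x a * char_of k w (\<lambda>i. a i - v i))" by (rule sum.swap)
  also have "\<dots> = (\<Sum>a\<in>?V. if a = v then x a * of_nat (card ?V) else 0)"
  proof (rule sum.cong[OF refl])
    fix a assume a: "a \<in> ?V"
    show "(\<Sum>w\<in>?V. x a * char_of k w (\<lambda>i. a i - v i)) = (if a = v then x a * of_nat (card ?V) else 0)"
    proof (cases "a = v")
      case True
      then show ?thesis by (simp add: char_of_def psi_0)
    next
      case False
      then obtain j where j: "a j \<noteq> v j" by auto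
      have "j \<in> {1..k}"
      proof (rule ccontr)
        assume "j \<notin> {1..k}"
        then have "j = 0 \<or> k < j" by auto
        then show False using a v j unfolding S_vertices_def by (metis (mono_tags, lifting) mem_Collect_eq)
      qed
      then have "(\<Sum>w\<in>?V. char_of k w (\<lambda>i. a i - v i)) = 0" using j by (intro sum_char_of_eq_0[of _ j]) auto
      then show ?thesis using False by (simp flip: sum_distrib_left)
    qed
  qed
  also have "\<dots> = x v * of_nat (card ?V)" using v by (simp add: finite_S_vertices)
  finally have "x v * of_nat (card ?V) = 0" by simp
  moreover have "card ?V \<noteq> 0" using v by (auto simp: card_eq_0_iff finite_S_vertices)
  ultimately show ?thesis by simp
qed

text \<open>Characters are eigenvectors of the transposed adjacency matrix. Some character has
  nonzero pairing with the given eigenvector, and this pairing forces the two eigenvalues to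
  agree.\<close>

lemma S_eigenvalue_is_fourier_eigenvalue:
  assumes k: "3 \<le> k" and ev: "S_eigenvalue k f g mu"
  shows "\<exists>w\<in>S_vertices k. complex_of_real mu = fourier_eigenvalue k f g w"
proof -
  let ?V = "S_vertices k :: (nat \<Rightarrow> 'a) set"
  obtain x :: "(nat \<Rightarrow> 'a) \<Rightarrow> real" and v where v: "v \<in> ?V" "x v \<noteq> 0"
    and x: "\<And>a. a \<in> ?V \<Longrightarrow> (\<Sum>b\<in>?V. (if S_adj k f g a b then 1 else 0) * x b) = mu * x a"
    using ev unfolding S_eigenvalue_def by blast
  define xh where "xh = (\<lambda>w. \<Sum>a\<in>?V. complex_of_real (x a) * char_of k w a)"
  obtain w where w: "w \<in> ?V" "xh w \<noteq> 0"
    using fourier_injective[of k "\<lambda>a. complex_of_real (x a)" v] v unfolding xh_def by auto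
  have "complex_of_real mu * xh w = (\<Sum>a\<in>?V. complex_of_real (mu * x a) * char_of k w a)"
    by (simp add: xh_def sum_distrib_left mult.assoc)
  also have "\<dots> = (\<Sum>a\<in>?V. (\<Sum>b\<in>?V. (if S_adj k f g a b then 1 else 0) * complex_of_real (x b)) * char_of k w a)"
  proof (rule sum.cong[OF refl])
    fix a assume "a \<in> ?V"
    then have "complex_of_real (mu * x a)
        = complex_of_real (\<Sum>b\<in>?V. (if S_adj k f g a b then 1 else 0) * x b)"
      by (simp only: x)
    also have "\<dots> = (\<Sum>b\<in>?V. (if S_adj k f g a b then 1 else 0) * complex_of_real (x b))"
      unfolding of_real_sum by (intro sum.cong) auto
    finally show "complex_of_real (mu * x a) * char_of k w a
        = (\<Sum>b\<in>?V. (if S_adj k f g a b then 1 else 0) * complex_of_real (x b)) * char_of k w a"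
      by (simp only:)
  qed
  also have "\<dots> = (\<Sum>a\<in>?V. \<Sum>b\<in>?V. complex_of_real (x b) * ((if S_adj k f g a b then 1 else 0) * char_of k w a))"
    unfolding sum_distrib_right by (intro sum.cong refl) simp
  also have "\<dots> = (\<Sum>b\<in>?V. \<Sum>a\<in>?V. complex_of_real (x b) * ((if S_adj k f g a b then 1 else 0) * char_of k w a))"
    by (rule sum.swap)
  also have "\<dots> = (\<Sum>b\<in>?V. complex_of_real (x b) * (char_of k w b * fourier_eigenvalue k f g w))"
  proof (rule sum.cong[OF refl])
    fix b assume b: "b \<in> ?V"
    have "(\<Sum>a\<in>?V. (if S_adj k f g a b then 1 else 0) * char_of k w a)
        = (\<Sum>(s,u)\<in>(UNIV - {0}) \<times> UNIV. char_of k w (\<lambda>i. b i - S_step k f g s u i))"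
      by (rule sum_S_adj_in[OF k b])
    also have "\<dots> = char_of k w b * (\<Sum>(s,u)\<in>(UNIV - {0}) \<times> UNIV. \<psi> (- poly (freq_poly k f g w u) s))"
      by (simp add: char_of_diff_step[OF k] sum_distrib_left case_prod_unfold)
    also have "(\<Sum>(s,u)\<in>(UNIV - {0}) \<times> UNIV. \<psi> (- poly (freq_poly k f g w u) s)) = fourier_eigenvalue k f g w"
      unfolding fourier_eigenvalue_def sum.cartesian_product[symmetric] by (rule sum.swap)
    finally show "(\<Sum>a\<in>?V. complex_of_real (x b) * ((if S_adj k f g a b then 1 else 0) * char_of k w a))
      = complex_of_real (x b) * (char_of k w b * fourier_eigenvalue k f g w)"
      by (simp only: sum_distrib_left[symmetric])
  qed
  also have "\<dots> = fourier_eigenvalue k f g w * xh w"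
    by (simp add: xh_def sum_distrib_left mult_ac)
  finally show ?thesis using w by auto
qed

lemma fourier_eigenvalue_bound:
  assumes k: "3 \<le> k" and g0: "\<forall>i\<in>{3..k}. poly (g i) 0 = 0"
    and df: "1 \<le> d_f k f" and dg: "1 \<le> d_f k g" "d_f k g < CHAR('a)"
    and nontriv: "\<exists>u. freq_poly k f g w u \<noteq> 0"
  shows "norm (fourier_eigenvalue k f g w)
    \<le> real (d_f k f) * real CARD('a) + real (d_f k g) * real CARD('a) * sqrt CARD('a)"
proof -
  let ?q = "CARD('a)" and ?H = "freq_poly k f g w"
  let ?I = "\<lambda>u. \<Sum>s\<in>UNIV - {0}. \<psi> (- poly (?H u) s)"
  have deg_f: "degree (f i) \<le> d_f k f" and deg_g: "degree (g i) \<le> d_f k g" if "i \<in> {3..k}" for i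
    using that unfolding d_f_def by (auto intro!: Max_ge)
  have q1: "?q \<ge> 1" by (simp add: Suc_le_eq)
  define Z where "Z = {u. ?H u = 0}"
  have cardZ: "card Z \<le> d_f k f"
  proof -
    obtain u0 j where j: "coeff (?H u0) j \<noteq> 0" using nontriv by (metis leading_coeff_0_iff)
    \<comment> \<open>For fixed \<open>j\<close>, the \<open>j\<close>-th coefficient of
      \<open>?H u\<close> is a polynomial in \<open>u\<close>. The part \<open>w 1 + w 2 * u\<close>
      has degree at most 1, which \<open>1 <= d_f k f\<close> accommodates.\<close>
    define c where "c = (if j = 1 then [:w 1, w 2:] else 0) + (\<Sum>i=3..k. smult (w i * coeff (g i) j) (f i))"
    have c: "poly c u = coeff (?H u) j" for u
      by (auto simp: c_def freq_poly_def coeff_sum poly_sum mult_ac)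
    have c0: "c \<noteq> 0" using j c[of u0] by auto
    have "degree c \<le> d_f k f"
      unfolding c_def using deg_f df
      by (intro degree_add_le degree_sum_le) (auto intro: order_trans[OF degree_smult_le] order_trans[OF degree_pCons_le])
    moreover have "card Z \<le> card {u. poly c u = 0}"
      using c by (intro card_mono) (auto simp: Z_def)
    ultimately show ?thesis using card_poly_roots_bound[OF c0] by linarith
  qed
  have bZ: "norm (?I u) \<le> ?q" for u
  proof -
    have "norm (?I u) \<le> (\<Sum>s\<in>UNIV - {0::'a}. 1)"
      by (rule order_trans[OF norm_sum]) (simp add: psi_norm)
    also have "\<dots> \<le> ?q" by (simp add: card_Diff_singleton)
    finally show ?thesis .
  qed
  have b: "norm (?I u) \<le> real (d_f k g) * sqrt ?q" if u: "?H u \<noteq> 0" for u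
  proof -
    \<comment> \<open>Without constant term, a nonzero \<open>?H u\<close> has degree between 1 and
      \<open>d_f k g\<close>, which is below the characteristic; so Weil's bound applies.\<close>
    have c0: "coeff (?H u) 0 = 0"
      using g0 by (auto simp: freq_poly_def coeff_sum poly_0_coeff_0 intro!: sum.neutral)
    have dpos: "degree (?H u) > 0"
    proof (rule ccontr)
      assume "\<not> ?thesis"
      then show False using u c0 by (metis gr_zeroI leading_coeff_0_iff)
    qed
    have dle: "degree (?H u) \<le> d_f k g"
      unfolding freq_poly_def using deg_g dg
      by (intro degree_add_le degree_sum_le) (auto intro: order_trans[OF degree_smult_le] order_trans[OF degree_monom_le])
    have ndvd: "\<not> CHAR('a) dvd degree (- ?H u)"
      using dpos dle dg by (auto dest!: dvd_imp_le)
    have "(\<Sum>s\<in>UNIV. \<psi> (poly (- ?H u) s)) = \<psi> (poly (- ?H u) 0) + ?I u"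
      by (subst sum.remove[of UNIV 0]) auto
    moreover have "\<psi> (poly (- ?H u) 0) = 1" using c0 by (simp add: poly_0_coeff_0 psi_0)
    ultimately have "?I u = (\<Sum>s\<in>UNIV. \<psi> (poly (- ?H u) s)) - 1" by simp
    then have "norm (?I u) \<le> norm (\<Sum>s\<in>UNIV. \<psi> (poly (- ?H u) s)) + 1"
      by (metis norm_one norm_triangle_ineq4)
    also have "norm (\<Sum>s\<in>UNIV. \<psi> (poly (- ?H u) s)) \<le> (real (degree (- ?H u)) - 1) * sqrt ?q"
      by (rule weil_bound_finite_field[OF ndvd])
    also have "\<dots> \<le> (real (d_f k g) - 1) * sqrt ?q"
      using dle by (intro mult_right_mono) auto
    \<comment> \<open>The excluded term \<open>s = 0\<close> costs 1, absorbed by the remaining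
      \<open>sqrt ?q\<close>.\<close>
    also have "(real (d_f k g) - 1) * sqrt ?q + 1 \<le> real (d_f k g) * sqrt ?q"
      using q1 by (simp add: algebra_simps)
    finally show ?thesis by simp
  qed
  have "norm (fourier_eigenvalue k f g w) \<le> (\<Sum>u\<in>UNIV. norm (?I u))"
    unfolding fourier_eigenvalue_def by (rule norm_sum)
  also have "\<dots> \<le> (\<Sum>u\<in>UNIV. (if u \<in> Z then real ?q else 0) + real (d_f k g) * sqrt ?q)"
  proof (rule sum_mono)
    fix u
    show "norm (?I u) \<le> (if u \<in> Z then real ?q else 0) + real (d_f k g) * sqrt ?q"
    proof (cases "u \<in> Z")
      case True
      have "0 \<le> real (d_f k g) * sqrt ?q" by simp
      with bZ[of u] have "norm (?I u) \<le> real ?q + real (d_f k g) * sqrt ?q" by linarith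
      with True show ?thesis by simp
    next
      case False
      then have "?H u \<noteq> 0" by (simp add: Z_def)
      from b[OF this] False show ?thesis by simp
    qed
  qed
  also have "\<dots> = real (card Z) * real ?q + real (d_f k g) * real ?q * sqrt ?q"
    by (simp add: sum.distrib sum.If_cases)
  also have "\<dots> \<le> real (d_f k f) * real ?q + real (d_f k g) * real ?q * sqrt ?q"
    using cardZ by (intro add_right_mono mult_right_mono) auto
  finally show ?thesis .
qed

lemma fourier_eigenvalue_trivial:
  assumes "\<forall>u. freq_poly k f g w u = 0"
  shows "fourier_eigenvalue k f g w = of_nat (CARD('a) * (CARD('a) - 1))"
  using assms by (simp add: fourier_eigenvalue_def psi_0 card_Diff_singleton)

end

text \<open>The set of eigenvalues in the theorem is non-empty, so its maximum is no junk value.\<close>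

lemma S_eigenvalue_minus_card:
  fixes f g :: "nat \<Rightarrow> 'a::{field,finite} poly"
  assumes k: "3 \<le> k"
  shows "S_eigenvalue k f g (- real CARD('a))"
proof -
  \<comment> \<open>Any nonzero function of the first coordinate with sum 0 over the field serves:
    each slope \<open>u\<close> contributes \<open>0 - \<xi> (a 1)\<close>, and there are
    \<open>CARD('a)\<close> slopes.\<close>
  define \<xi> :: "'a \<Rightarrow> real" where "\<xi> = (\<lambda>c. (if c = 0 then 1 else 0) - (if c = 1 then 1 else 0))"
  have "(\<Sum>b\<in>S_vertices k. (if S_adj k f g a b then 1 else 0) * \<xi> (b 1)) = - real CARD('a) * \<xi> (a 1)"
    if a: "a \<in> S_vertices k" for a
  proof -
    have "(\<Sum>b\<in>S_vertices k. (if S_adj k f g a b then 1 else 0) * \<xi> (b 1))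
        = (\<Sum>(s,u)\<in>(UNIV - {0}) \<times> (UNIV::'a set). \<xi> (a 1 + s))"
      by (subst sum_S_adj_out[OF k a]) simp
    also have "\<dots> = real CARD('a) * (\<Sum>s\<in>UNIV - {0}. \<xi> (a 1 + s))"
      unfolding sum.cartesian_product[symmetric] by (simp add: sum_distrib_left)
    also have "(\<Sum>s\<in>UNIV - {0}. \<xi> (a 1 + s)) = (\<Sum>s\<in>UNIV. \<xi> (a 1 + s)) - \<xi> (a 1)"
      by (subst sum_diff1) auto
    also have "(\<Sum>s\<in>UNIV. \<xi> (a 1 + s)) = (\<Sum>c\<in>UNIV. \<xi> c)"
      by (rule sum.reindex_bij_witness[of _ "\<lambda>c. c - a 1" "\<lambda>s. a 1 + s"]) auto
    also have "\<dots> = 0" by (simp add: \<xi>_def sum_subtractf)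
    finally show ?thesis by simp
  qed
  moreover have "(\<lambda>_. 0) \<in> (S_vertices k :: (nat \<Rightarrow> 'a) set)" "\<xi> 0 \<noteq> 0"
    by (auto simp: S_vertices_def \<xi>_def)
  ultimately show ?thesis
    unfolding S_eigenvalue_def by (intro exI[of _ "\<lambda>b. \<xi> (b 1)"]) (auto intro!: bexI[of _ "\<lambda>_. 0"])
qed

theorem mainTheorem7:
  fixes k :: nat and f g :: "nat \<Rightarrow> 'a::{field,finite} poly"
  assumes k3: "3 \<le> k"
    and degf: "\<forall>i\<in>{3..k}. degree (f i) \<le> CARD('a) - 1"
    and degg: "\<forall>i\<in>{3..k}. degree (g i) \<le> CARD('a) - 1"
    and godd: "\<forall>i\<in>{3..k}. g i \<circ>\<^sub>p [:0, -1:] = - g i"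
    and g0: "\<forall>i\<in>{3..k}. poly (g i) 0 = 0"
    and df1: "1 \<le> d_f k f"
    and dg1: "1 \<le> d_f k g"
    and dgp: "d_f k g < CHAR('a)"
  shows "Max {mu. S_eigenvalue k f g mu \<and> mu \<noteq> real (CARD('a) * (CARD('a) - 1))}
           \<le> real (d_f k f) * real CARD('a) + real (d_f k g) * real CARD('a) powr (3/2)"
proof -
  obtain \<psi> :: "'a \<Rightarrow> complex" where "finite_field_character \<psi>"
    using exists_finite_field_character by blast
  then interpret finite_field_character \<psi> .
  let ?q = "CARD('a)"
  let ?E = "{mu. S_eigenvalue k f g mu \<and> mu \<noteq> real (?q * (?q - 1))}"
  have ex: "\<exists>w\<in>S_vertices k. complex_of_real mu = fourier_eigenvalue k f g w" if "mu \<in> ?E" for mu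
    using S_eigenvalue_is_fourier_eigenvalue[OF k3] that by blast
  \<comment> \<open>\<open>Max\<close> also needs a finite set; there are only finitely many
    frequencies.\<close>
  have "?E \<subseteq> (\<lambda>w. Re (fourier_eigenvalue k f g w)) ` S_vertices k"
    using ex by (metis (no_types, lifting) Re_complex_of_real image_eqI subsetI)
  then have fin: "finite ?E" by (rule finite_subset) (simp add: finite_S_vertices)
  have "- real ?q < 0" by simp
  then have "- real ?q \<noteq> real (?q * (?q - 1))" using of_nat_0_le_iff[of "?q * (?q - 1)"] by linarith
  then have "- real ?q \<in> ?E" using S_eigenvalue_minus_card[OF k3, of f g] by blast
  then have ne: "?E \<noteq> {}" by blast
  have powr: "real ?q powr (3 / 2) = real ?q * sqrt ?q"
    using powr_add[of "real ?q" 1 "1/2"] by (simp add: powr_half_sqrt)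
  have "mu \<le> real (d_f k f) * real ?q + real (d_f k g) * real ?q powr (3/2)" if mu: "mu \<in> ?E" for mu
  proof -
    obtain w where w: "complex_of_real mu = fourier_eigenvalue k f g w" using ex[OF mu] by blast
    \<comment> \<open>A frequency for which every \<open>H_u\<close> is zero yields the excluded
      eigenvalue \<open>q * (q - 1)\<close>.\<close>
    have "\<exists>u. freq_poly k f g w u \<noteq> 0"
    proof (rule ccontr)
      assume "\<nexists>u. freq_poly k f g w u \<noteq> 0"
      then have "complex_of_real mu = complex_of_real (real (?q * (?q - 1)))"
        unfolding w using fourier_eigenvalue_trivial[of k f g w] by (simp only: of_real_of_nat_eq) blast
      then have "mu = real (?q * (?q - 1))" by (simp only: of_real_eq_iff)
      then show False using mu by blast
    qed
    from fourier_eigenvalue_bound[OF k3 g0 df1 dg1 dgp this]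
    have "norm (complex_of_real mu) \<le> real (d_f k f) * real ?q + real (d_f k g) * real ?q powr (3/2)"
      unfolding w powr by (simp only: mult.assoc)
    then show ?thesis by simp
  qed
  with fin ne show ?thesis by (intro Max.boundedI)
qed

end
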